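(* Let $X$ be a topological vector space and let $V\subset X$ be a closed convex cone. The canonical mapping $j:\mathcal{C}_V(X)\to j(\mathcal{C}_V(X))\subset\widetilde{\mathcal{C}}_V(X)$, $j(A)=[A,V]$, is an isomorphic embedding of the topological abstract convex cone $(\mathcal{C}_V(X),\dot{+},\cdot,\tau_H)$ into the real topological vector space $(\widetilde{\mathcal{C}}_V(X),+,\cdot,\sigma_H)$. Moreover, the canonical mapping $j:\mathcal{C}_V(X)\to j(\mathcal{C}_V(X))\subset\widetilde{\mathcal{C}}_V(X)$ is a homeomorphism (onto its image).
   Context: Topological vector spaces are real. $\mathcal{C}(X)$ is the family of all nonempty closed convex subsets of $X$, $\mathcal{B}(X)$ the family of all nonempty bounded closed convex subsets of $X$. The addition is $A\dot{+}B=\operatorname{cl}\{a+b:a\in A,b\in B\}$. $\mathcal{C}_V(X)=\{A\in\mathcal{C}(X): A\subset V\dot{+}D\text{ and }V\subset A\dot{+}D\text{ for some }D\in\mathcal{B}(X)\}$. With $\dot{+}$ and the multiplication $\lambda A=\{\lambda a:a\in A\}$ for $\lambda>0$, $0\cdot A=V$, the family $\mathcal{C}_V(X)$ is an abstract convex cone, i.e. $\dot{+}$ is associative and commutative with a neutral element (here $V$), and $1\cdot A=A$, $\alpha(\beta A)=(\alpha\beta)A$, $\alpha(A\dot{+}B)=\alpha A\dot{+}\alpha B$, $(\alpha+\beta)A=\alpha A\dot{+}\beta A$, $0\cdot A=V$ for all $\alpha,\beta\geqslant 0$. On $\mathcal{C}_V(X)\times\mathcal{C}_V(X)$ define the equivalence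 relation $(A,B)\sim(C,D)\iff A\dot{+}D=B\dot{+}C$; $\widetilde{\mathcal{C}}_V(X)$ is the set of equivalence classes, $[A,B]$ being the class of $(A,B)$. It is a real vector space with $[A,B]+[C,D]:=[A\dot{+}C,B\dot{+}D]$, and $\lambda[A,B]:=[\lambda A,\lambda B]$ if $\lambda\geqslant 0$, $\lambda[A,B]:=[(-\lambda)B,(-\lambda)A]$ if $\lambda\leqslant 0$. Let $\mathcal{W}$ be a basis of balanced neighbourhoods of $0$ in $X$. For $U\in\mathcal{W}$ let $W_U=\{(A,B)\in(\mathcal{C}_V(X))^2: A\subset B\dot{+}K,\ B\subset A\dot{+}K\text{ for some }K\in\mathcal{C}(X),\ K\subset U\}$. The family $\{W_U\}_{U\in\mathcal{W}}$ is a basis of a uniformity on $\mathcal{C}_V(X)$; $\tau_H$ is the topology it induces. For $U\in\mathcal{W}$ let $\mathcal{T}_U=\{[A,B]\in\widetilde{\mathcal{C}}_V(X): A\subset B\dot{+}K,\ B\subset A\dot{+}K\text{ for some }K\in\mathcal{C}(X),\ K\subset U\}$. The family $\{\mathcal{T}_U\}_{U\in\mathcal{W}}$ is a basis of neighbourhoods of $0$ for a linear topology on $\widetilde{\mathcal{C}}_V(X)$, denoted $\sigma_H$. "Isomorphic embedding" means that $j$ is injective with $j(A\dot{+}B)=j(A)+j(B)$ and $j(\lambda A)=\lambda j(A)$ for all $A,B\in\mathcal{C}_V(X)$, $\lambda\geqslant 0$. *)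

theory Defs
  imports "HOL-Analysis.Analysis"
begin

text \<open>No Hausdorff axiom is imposed; the scalar axiom is joint continuity, in the style of
  the library class \<^class>\<open>topological_monoid_add\<close>.\<close>

class real_tvs = real_vector + topological_ab_group_add +
  assumes tendsto_scaleR_Pair:
    "LIM p (nhds (r::real) \<times>\<^sub>F nhds x). fst p *\<^sub>R snd p :> nhds (r *\<^sub>R x)"

instance real_normed_vector \<subseteq> real_tvs
proof
  fix r :: real and x :: 'a
  show "LIM p (nhds r \<times>\<^sub>F nhds x). fst p *\<^sub>R snd p :> nhds (r *\<^sub>R x)"
    by (intro tendsto_scaleR filterlim_fst filterlim_snd)
qed

definition balanced :: "'a::real_vector set \<Rightarrow> bool" where
  "balanced S \<longleftrightarrow> (\<forall>r x. \<bar>r\<bar> \<le> 1 \<and> x \<in> S \<longrightarrow> r *\<^sub>R x \<in> S)"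

text \<open>Neighbourhoods are not required to be open.\<close>

definition balanced_nhds_basis :: "'a::real_tvs set set \<Rightarrow> bool" where
  "balanced_nhds_basis \<W> \<longleftrightarrow>
     (\<forall>U\<in>\<W>. balanced U \<and> 0 \<in> interior U) \<and>
     (\<forall>N. 0 \<in> interior N \<longrightarrow> (\<exists>U\<in>\<W>. U \<subseteq> N))"

text \<open>The library's \<^const>\<open>bounded\<close> is metric; this is boundedness in the sense of
  topological vector spaces (absorbed by every neighbourhood of the origin).\<close>

definition tvs_bounded :: "'a::real_tvs set \<Rightarrow> bool" where
  "tvs_bounded S \<longleftrightarrow>
     (\<forall>N. 0 \<in> interior N \<longrightarrow> (\<exists>s>0. \<forall>t\<ge>s. S \<subseteq> (\<lambda>x. t *\<^sub>R x) ` N))"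

definition CC :: "'a::real_tvs set set" where
  "CC = {A. A \<noteq> {} \<and> closed A \<and> convex A}"

definition BCC :: "'a::real_tvs set set" where
  "BCC = {A \<in> CC. tvs_bounded A}"

definition cadd :: "'a::real_tvs set \<Rightarrow> 'a set \<Rightarrow> 'a set" (infixl \<open>\<dotplus>\<close> 65) where
  "A \<dotplus> B = closure {a + b | a b. a \<in> A \<and> b \<in> B}"

definition CV :: "'a::real_tvs set \<Rightarrow> 'a set set" where
  "CV V = {A \<in> CC. \<exists>D\<in>BCC. A \<subseteq> V \<dotplus> D \<and> V \<subseteq> A \<dotplus> D}"

text \<open>Only used for nonnegative scalars.\<close>

definition cmul :: "'a::real_tvs set \<Rightarrow> real \<Rightarrow> 'a set \<Rightarrow> 'a set" where
  "cmul V r A = (if r = 0 then V else (\<lambda>x. r *\<^sub>R x) ` A)"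

definition near :: "'a::real_tvs set \<Rightarrow> 'a set \<Rightarrow> 'a set \<Rightarrow> bool" where
  "near U A B \<longleftrightarrow> (\<exists>K\<in>CC. K \<subseteq> U \<and> A \<subseteq> B \<dotplus> K \<and> B \<subseteq> A \<dotplus> K)"

definition WU :: "'a::real_tvs set \<Rightarrow> 'a set \<Rightarrow> ('a set \<times> 'a set) set" where
  "WU V U = {(A, B). A \<in> CV V \<and> B \<in> CV V \<and> near U A B}"

text \<open>The topology induced by the uniformity with basis \<open>WU V U\<close>, \<open>U \<in> \<W>\<close>: a set is open iff
  with every point it contains a ball of some entourage. That these sets form a topology is
  lemma \<open>istopology_tauH\<close> below.\<close>

definition tauH :: "'a::real_tvs set \<Rightarrow> 'a set set \<Rightarrow> 'a set topology" where
  "tauH V \<W> = topology (\<lambda>G. G \<subseteq> CV V \<and> (\<forall>A\<in>G. \<exists>U\<in>\<W>. WU V U `` {A} \<subseteq> G))"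

definition mrh_rel :: "'a::real_tvs set \<Rightarrow> (('a set \<times> 'a set) \<times> ('a set \<times> 'a set)) set" where
  "mrh_rel V = {((A, B), (C, D)).
     A \<in> CV V \<and> B \<in> CV V \<and> C \<in> CV V \<and> D \<in> CV V \<and> A \<dotplus> D = B \<dotplus> C}"

definition mrh :: "'a::real_tvs set \<Rightarrow> ('a set \<times> 'a set) set set" where
  "mrh V = (CV V \<times> CV V) // mrh_rel V"

definition mrh_class :: "'a::real_tvs set \<Rightarrow> 'a set \<Rightarrow> 'a set \<Rightarrow> ('a set \<times> 'a set) set" where
  "mrh_class V A B = mrh_rel V `` {(A, B)}"

text \<open>Operations on classes are the unions, over all representatives, of the resulting classes;
  as the operations respect the relation, all classes in the union coincide.\<close>

definition mrh_add ::
  "'a::real_tvs set \<Rightarrow> ('a set \<times> 'a set) set \<Rightarrow> ('a set \<times> 'a set) set \<Rightarrow> ('a set \<times> 'a set) set"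
  where
  "mrh_add V p q = (\<Union>(A, B)\<in>p. \<Union>(C, D)\<in>q. mrh_class V (A \<dotplus> C) (B \<dotplus> D))"

definition mrh_scale ::
  "'a::real_tvs set \<Rightarrow> real \<Rightarrow> ('a set \<times> 'a set) set \<Rightarrow> ('a set \<times> 'a set) set" where
  "mrh_scale V r p = (\<Union>(A, B)\<in>p.
     if r \<ge> 0 then mrh_class V (cmul V r A) (cmul V r B)
     else mrh_class V (cmul V (- r) B) (cmul V (- r) A))"

definition TU :: "'a::real_tvs set \<Rightarrow> 'a set \<Rightarrow> ('a set \<times> 'a set) set set" where
  "TU V U = {mrh_class V A B | A B. A \<in> CV V \<and> B \<in> CV V \<and> near U A B}"

text \<open>The translation-invariant topology with the sets \<open>TU V U\<close>, \<open>U \<in> \<W>\<close>, as basic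
  neighbourhoods of the origin; see lemma \<open>istopology_sigmaH\<close>.\<close>

definition sigmaH :: "'a::real_tvs set \<Rightarrow> 'a set set \<Rightarrow> ('a set \<times> 'a set) set topology" where
  "sigmaH V \<W> = topology (\<lambda>G. G \<subseteq> mrh V \<and> (\<forall>p\<in>G. \<exists>U\<in>\<W>. mrh_add V p ` TU V U \<subseteq> G))"

definition canon :: "'a::real_tvs set \<Rightarrow> 'a set \<Rightarrow> ('a set \<times> 'a set) set" where
  "canon V A = mrh_class V A V"

locale abstract_convex_cone =
  fixes S :: "'b set" and add :: "'b \<Rightarrow> 'b \<Rightarrow> 'b" and zero :: 'b and scale :: "real \<Rightarrow> 'b \<Rightarrow> 'b"
  assumes add_closed: "x \<in> S \<Longrightarrow> y \<in> S \<Longrightarrow> add x y \<in> S"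
    and zero_closed: "zero \<in> S"
    and scale_closed: "r \<ge> 0 \<Longrightarrow> x \<in> S \<Longrightarrow> scale r x \<in> S"
    and add_assoc: "x \<in> S \<Longrightarrow> y \<in> S \<Longrightarrow> z \<in> S \<Longrightarrow> add (add x y) z = add x (add y z)"
    and add_commute: "x \<in> S \<Longrightarrow> y \<in> S \<Longrightarrow> add x y = add y x"
    and add_zero: "x \<in> S \<Longrightarrow> add x zero = x"
    and scale_one: "x \<in> S \<Longrightarrow> scale 1 x = x"
    and scale_scale: "r \<ge> 0 \<Longrightarrow> s \<ge> 0 \<Longrightarrow> x \<in> S \<Longrightarrow> scale r (scale s x) = scale (r * s) x"
    and scale_add_right:
      "r \<ge> 0 \<Longrightarrow> x \<in> S \<Longrightarrow> y \<in> S \<Longrightarrow> scale r (add x y) = add (scale r x) (scale r y)"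
    and scale_add_left:
      "r \<ge> 0 \<Longrightarrow> s \<ge> 0 \<Longrightarrow> x \<in> S \<Longrightarrow> scale (r + s) x = add (scale r x) (scale s x)"
    and scale_zero: "x \<in> S \<Longrightarrow> scale 0 x = zero"

locale topological_convex_cone = abstract_convex_cone S add zero scale
  for S :: "'b set" and add zero scale +
  fixes T :: "'b topology"
  assumes topspace_eq: "topspace T = S"
    and continuous_add: "continuous_map (prod_topology T T) T (\<lambda>(x, y). add x y)"
    and continuous_scale:
      "continuous_map (prod_topology (top_of_set {0::real..}) T) T (\<lambda>(r, x). scale r x)"

locale real_vector_space_on =
  fixes S :: "'b set" and add :: "'b \<Rightarrow> 'b \<Rightarrow> 'b" and zero :: 'b and scale :: "real \<Rightarrow> 'b \<Rightarrow> 'b"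
  assumes add_closed: "x \<in> S \<Longrightarrow> y \<in> S \<Longrightarrow> add x y \<in> S"
    and zero_closed: "zero \<in> S"
    and scale_closed: "x \<in> S \<Longrightarrow> scale r x \<in> S"
    and add_assoc: "x \<in> S \<Longrightarrow> y \<in> S \<Longrightarrow> z \<in> S \<Longrightarrow> add (add x y) z = add x (add y z)"
    and add_commute: "x \<in> S \<Longrightarrow> y \<in> S \<Longrightarrow> add x y = add y x"
    and add_zero: "x \<in> S \<Longrightarrow> add x zero = x"
    and add_inverse: "x \<in> S \<Longrightarrow> \<exists>y\<in>S. add x y = zero"
    and scale_one: "x \<in> S \<Longrightarrow> scale 1 x = x"
    and scale_scale: "x \<in> S \<Longrightarrow> scale r (scale s x) = scale (r * s) x"
    and scale_add_right: "x \<in> S \<Longrightarrow> y \<in> S \<Longrightarrow> scale r (add x y) = add (scale r x) (scale r y)"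
    and scale_add_left: "x \<in> S \<Longrightarrow> scale (r + s) x = add (scale r x) (scale s x)"

locale real_tvs_on = real_vector_space_on S add zero scale
  for S :: "'b set" and add zero scale +
  fixes T :: "'b topology"
  assumes topspace_eq: "topspace T = S"
    and continuous_add: "continuous_map (prod_topology T T) T (\<lambda>(x, y). add x y)"
    and continuous_scale: "continuous_map (prod_topology euclideanreal T) T (\<lambda>(r, x). scale r x)"

lemma near_mono: "near U A B \<Longrightarrow> U \<subseteq> U' \<Longrightarrow> near U' A B"
  unfolding near_def by blast

lemma WU_mono: "U \<subseteq> U' \<Longrightarrow> WU V U \<subseteq> WU V U'"
  unfolding WU_def using near_mono by blast

lemma TU_mono: "U \<subseteq> U' \<Longrightarrow> TU V U \<subseteq> TU V U'"
  unfolding TU_def using near_mono by blast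

lemma balanced_nhds_basis_directed:
  assumes "balanced_nhds_basis \<W>" "U \<in> \<W>" "U' \<in> \<W>"
  obtains U'' where "U'' \<in> \<W>" "U'' \<subseteq> U" "U'' \<subseteq> U'"
proof -
  have "0 \<in> interior (U \<inter> U')"
    using assms unfolding balanced_nhds_basis_def by simp
  then obtain U'' where "U'' \<in> \<W>" "U'' \<subseteq> U \<inter> U'"
    using assms(1) unfolding balanced_nhds_basis_def by meson
  then show ?thesis
    using that by blast
qed

lemma istopology_directed:
  assumes "\<And>U U'. U \<in> \<W> \<Longrightarrow> U' \<in> \<W> \<Longrightarrow> \<exists>U''\<in>\<W>. \<forall>x. N U'' x \<subseteq> N U x \<inter> N U' x"
  shows "istopology (\<lambda>G. G \<subseteq> S \<and> (\<forall>x\<in>G. \<exists>U\<in>\<W>. N U x \<subseteq> G))"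
  unfolding istopology_def
proof (intro conjI allI impI)
  fix O1 O2
  assume *: "O1 \<subseteq> S \<and> (\<forall>x\<in>O1. \<exists>U\<in>\<W>. N U x \<subseteq> O1)" "O2 \<subseteq> S \<and> (\<forall>x\<in>O2. \<exists>U\<in>\<W>. N U x \<subseteq> O2)"
  then show "O1 \<inter> O2 \<subseteq> S" by blast
  show "\<forall>x\<in>O1 \<inter> O2. \<exists>U\<in>\<W>. N U x \<subseteq> O1 \<inter> O2"
  proof
    fix x assume "x \<in> O1 \<inter> O2"
    then obtain U U' where "U \<in> \<W>" "N U x \<subseteq> O1" "U' \<in> \<W>" "N U' x \<subseteq> O2"
      using * by blast
    then show "\<exists>U\<in>\<W>. N U x \<subseteq> O1 \<inter> O2"
      using assms[of U U'] by blast
  qed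
next
  fix \<K>
  assume *: "\<forall>K\<in>\<K>. K \<subseteq> S \<and> (\<forall>x\<in>K. \<exists>U\<in>\<W>. N U x \<subseteq> K)"
  then show "\<Union>\<K> \<subseteq> S" by blast
  show "\<forall>x\<in>\<Union>\<K>. \<exists>U\<in>\<W>. N U x \<subseteq> \<Union>\<K>"
    using * by (meson Sup_upper UnionE order_trans)
qed

lemma istopology_tauH:
  assumes "balanced_nhds_basis \<W>"
  shows "istopology (\<lambda>G. G \<subseteq> CV V \<and> (\<forall>A\<in>G. \<exists>U\<in>\<W>. WU V U `` {A} \<subseteq> G))"
proof (rule istopology_directed)
  fix U U' assume "U \<in> \<W>" "U' \<in> \<W>"
  with assms obtain U'' where "U'' \<in> \<W>" "U'' \<subseteq> U" "U'' \<subseteq> U'"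
    by (rule balanced_nhds_basis_directed)
  then show "\<exists>U''\<in>\<W>. \<forall>x. WU V U'' `` {x} \<subseteq> WU V U `` {x} \<inter> WU V U' `` {x}"
    using WU_mono by (meson Image_mono Int_greatest order_refl)
qed

lemma istopology_sigmaH:
  assumes "balanced_nhds_basis \<W>"
  shows "istopology (\<lambda>G. G \<subseteq> mrh V \<and> (\<forall>p\<in>G. \<exists>U\<in>\<W>. mrh_add V p ` TU V U \<subseteq> G))"
proof (rule istopology_directed)
  fix U U' assume "U \<in> \<W>" "U' \<in> \<W>"
  with assms obtain U'' where "U'' \<in> \<W>" "U'' \<subseteq> U" "U'' \<subseteq> U'"
    by (rule balanced_nhds_basis_directed)
  then show "\<exists>U''\<in>\<W>. \<forall>p. mrh_add V p ` TU V U'' \<subseteq> mrh_add V p ` TU V U \<inter> mrh_add V p ` TU V U'"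
    using TU_mono by (meson image_mono Int_greatest)
qed

lemma openin_tauH:
  assumes "balanced_nhds_basis \<W>"
  shows "openin (tauH V \<W>) G \<longleftrightarrow> G \<subseteq> CV V \<and> (\<forall>A\<in>G. \<exists>U\<in>\<W>. WU V U `` {A} \<subseteq> G)"
  unfolding tauH_def topology_inverse'[OF istopology_tauH[OF assms]] by (rule refl)

lemma openin_sigmaH:
  assumes "balanced_nhds_basis \<W>"
  shows "openin (sigmaH V \<W>) G \<longleftrightarrow>
    G \<subseteq> mrh V \<and> (\<forall>p\<in>G. \<exists>U\<in>\<W>. mrh_add V p ` TU V U \<subseteq> G)"
  unfolding sigmaH_def topology_inverse'[OF istopology_sigmaH[OF assms]] by (rule refl)

end

theory Submission
  imports Defs
begin

text \<open>
  Everything rests on two facts about the sets in \<open>CV V\<close>. Such a set absorbs the cone,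
  \<open>A \<dotplus> V = A\<close> (lemma \<open>cadd_V_absorb\<close>), so \<open>V\<close> is neutral. And the sets can be cancelled:
  \<open>A \<dotplus> C \<subseteq> B \<dotplus> C\<close> implies \<open>A \<subseteq> B\<close> (lemma \<open>subset_if_cadd_subset\<close>). Classically this holds for
  bounded \<open>C\<close>; here \<open>C\<close> is bounded up to the cone, and the cone is absorbed by \<open>B\<close>. Both facts come
  from an inclusion for \<open>n\<close>-fold multiples: after division by \<open>n\<close> the bounded parts vanish as \<open>n\<close>
  grows (lemma \<open>in_closure_if_perturbed\<close>).

  Absorption yields the axioms of an abstract convex cone. Cancellation makes equality of formal
  differences an equivalence relation, turns the classes into a vector space, and makes the canonical
  map injective. It also makes the closeness relation \<open>near\<close> invariant under adding a common summand
  (lemma \<open>near_cadd_cancel\<close>). Consequently the sets \<open>TU V U\<close> do not depend on representatives and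
  satisfy the usual conditions on a basis of neighbourhoods of the origin, the absorbing property being
  lemma \<open>near_small_multiples\<close>; so the space of classes is a topological vector space.

  The same invariance gives that \<open>canon V B - canon V A\<close> lies in \<open>TU V U\<close> exactly when \<open>A\<close> and \<open>B\<close>
  are \<open>U\<close>-close (lemma \<open>canon_mem_ball_iff\<close>). Hence the canonical map matches the balls of the two
  topologies and is a homeomorphism onto its image. Continuity of the cone operations is then
  inherited from the vector space.
\<close>

section \<open>Closures, sums and multiples of sets\<close>

lemma tendsto_scaleR_tvs:
  fixes g :: "'b \<Rightarrow> 'a::real_tvs"
  assumes "(f \<longlongrightarrow> r) F" "(g \<longlongrightarrow> x) F"
  shows "((\<lambda>t. f t *\<^sub>R g t) \<longlongrightarrow> r *\<^sub>R x) F"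
  using filterlim_compose[OF tendsto_scaleR_Pair, of "\<lambda>t. (f t, g t)" r x F] assms
  by (simp add: nhds_prod[symmetric] tendsto_Pair)

lemma continuous_on_scaleR_tvs: "continuous_on S (\<lambda>x::'a::real_tvs. r *\<^sub>R x)"
  by (auto simp: continuous_on_def intro!: tendsto_scaleR_tvs tendsto_ident_at)

lemma eventually_scaleR_small:
  fixes x :: "'a::real_tvs"
  assumes "open M" "0 \<in> M"
  shows "\<forall>\<^sub>F t in nhds (0::real). t *\<^sub>R x \<in> M"
proof -
  have "((\<lambda>t::real. t *\<^sub>R x) \<longlongrightarrow> 0 *\<^sub>R x) (nhds 0)"
    by (intro tendsto_scaleR_tvs tendsto_const filterlim_ident)
  then show ?thesis
    using assms by (simp add: tendsto_def)
qed

lemma open_nhds_third: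
  fixes N :: "'a::topological_monoid_add set"
  assumes "0 \<in> interior N"
  obtains M where "open M" "0 \<in> M" "M + M + M \<subseteq> N"
proof -
  have half: "\<exists>M. open M \<and> 0 \<in> M \<and> M + M \<subseteq> O'" if "open O'" "(0::'a) \<in> O'" for O'
  proof -
    have "\<forall>\<^sub>F p in nhds (0::'a, 0::'a). fst p + snd p \<in> O'"
      using tendsto_add_Pair[of "0::'a" 0] that by (simp add: tendsto_def nhds_prod)
    then obtain Q where "open Q" "(0, 0) \<in> Q" "\<forall>p\<in>Q. fst p + snd p \<in> O'"
      by (auto simp: eventually_nhds)
    then obtain A B where "open A" "open B" "0 \<in> A" "0 \<in> B" "A \<times> B \<subseteq> Q"
      by (auto elim: open_prod_elim)
    with \<open>\<forall>p\<in>Q. fst p + snd p \<in> O'\<close> show ?thesis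
      by (intro exI[of _ "A \<inter> B"]) (fastforce elim!: set_plus_elim)
  qed
  obtain M1 where M1: "open M1" "0 \<in> M1" "M1 + M1 \<subseteq> interior N"
    using half[of "interior N"] assms by auto
  obtain M2 where M2: "open M2" "0 \<in> M2" "M2 + M2 \<subseteq> M1"
    using half[of M1] M1 by auto
  have "M2 \<subseteq> M1"
    using M2 set_plus_intro[of 0 M2 _ M2] by fastforce
  then have "M2 + M2 + M2 \<subseteq> M1 + M1"
    by (intro set_plus_mono2 M2(3))
  then show ?thesis
    using that[OF M2(1,2)] M1(3) interior_subset by blast
qed

text \<open>In this form closures can be handled by adding neighbourhoods of the origin instead of
  translating them to points.\<close>

lemma in_closure_iff_add_nhds:
  fixes S :: "'a::topological_ab_group_add set"
  shows "x \<in> closure S \<longleftrightarrow> (\<forall>M. open M \<longrightarrow> 0 \<in> M \<longrightarrow> x \<in> S + M)"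
proof (intro iffI allI impI)
  fix M :: "'a set" assume "x \<in> closure S" "open M" "0 \<in> M"
  have "open ((\<lambda>s. x - s) -` M)"
    by (intro open_vimage \<open>open M\<close> continuous_intros)
  moreover have "x \<in> (\<lambda>s. x - s) -` M"
    using \<open>0 \<in> M\<close> by simp
  ultimately obtain s where "s \<in> S" "x - s \<in> M"
    using \<open>x \<in> closure S\<close> open_Int_closure_eq_empty[of "(\<lambda>s. x - s) -` M" S] by blast
  then show "x \<in> S + M"
    using set_plus_intro[of s S "x - s" M] by simp
next
  assume *: "\<forall>M. open M \<longrightarrow> 0 \<in> M \<longrightarrow> x \<in> S + M"
  show "x \<in> closure S"
  proof (rule ccontr)
    assume "x \<notin> closure S"
    then have "0 \<in> (\<lambda>m. x - m) -` (- closure S)" by simp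
    moreover have "open ((\<lambda>m. x - m) -` (- closure S))"
      by (intro open_vimage continuous_intros) auto
    ultimately have "x \<in> S + (\<lambda>m. x - m) -` (- closure S)"
      using * by blast
    then obtain s m where "s \<in> S" "x - m \<notin> closure S" "x = s + m"
      by (auto elim!: set_plus_elim)
    then show False
      using closure_subset by auto
  qed
qed

lemma closure_add_subset:
  fixes A B :: "'a::topological_monoid_add set"
  shows "closure A + closure B \<subseteq> closure (A + B)"
proof -
  have "(\<lambda>p. fst p + snd p) ` closure (A \<times> B) \<subseteq> closure (A + B)"
    by (rule image_closure_subset)
      (auto intro!: continuous_intros closure_subset[THEN subsetD] set_plus_intro)
  then show ?thesis
    by (force simp: closure_Times elim!: set_plus_elim)
qed

text \<open>Errors of approximation can be discarded inside a sum that is closed afterwards. This makes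
  \<open>\<dotplus>\<close> associative, and it lets inclusions up to closure be iterated without any bookkeeping
  of neighbourhoods.\<close>

lemma closure_add_closure:
  fixes A B :: "'a::topological_monoid_add set"
  shows "closure (closure A + B) = closure (A + B)"
proof
  have "closure A + B \<subseteq> closure A + closure B"
    by (intro set_plus_mono2 closure_subset order_refl)
  then show "closure (closure A + B) \<subseteq> closure (A + B)"
    by (meson closed_closure closure_add_subset closure_minimal order_trans)
  show "closure (A + B) \<subseteq> closure (closure A + B)"
    by (intro closure_mono set_plus_mono2 closure_subset order_refl)
qed

lemma closure_add_nhds:
  fixes N :: "'a::topological_ab_group_add set"
  assumes "0 \<in> interior N"
  obtains M where "open M" "0 \<in> M" "closure (M + M) \<subseteq> N"
proof -
  obtain M where M: "open M" "0 \<in> M" "M + M + M \<subseteq> N"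
    using open_nhds_third[OF assms] .
  then have "closure (M + M) \<subseteq> M + M + M"
    using in_closure_iff_add_nhds by blast
  with M that show ?thesis by blast
qed

lemma scaleR_set_plus:
  "(\<lambda>x::'a::real_vector. r *\<^sub>R x) ` (A + B) = (\<lambda>x. r *\<^sub>R x) ` A + (\<lambda>x. r *\<^sub>R x) ` B"
proof
  show "(\<lambda>x. r *\<^sub>R x) ` (A + B) \<subseteq> (\<lambda>x. r *\<^sub>R x) ` A + (\<lambda>x. r *\<^sub>R x) ` B"
    by (auto simp: scaleR_add_right elim!: set_plus_elim intro!: set_plus_intro)
  show "(\<lambda>x. r *\<^sub>R x) ` A + (\<lambda>x. r *\<^sub>R x) ` B \<subseteq> (\<lambda>x. r *\<^sub>R x) ` (A + B)"
    by (auto simp: scaleR_add_right[symmetric] elim!: set_plus_elim)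
qed

lemma scaleR_closure_subset:
  "(\<lambda>x::'a::real_tvs. r *\<^sub>R x) ` closure A \<subseteq> closure ((\<lambda>x. r *\<^sub>R x) ` A)"
  by (rule image_closure_subset[OF continuous_on_scaleR_tvs closed_closure closure_subset])

lemma scaleR_image_subset_iff:
  "r \<noteq> 0 \<Longrightarrow> (\<lambda>x::'a::real_vector. r *\<^sub>R x) ` A \<subseteq> B \<longleftrightarrow> A \<subseteq> (\<lambda>x. (1 / r) *\<^sub>R x) ` B"
  by (auto simp: image_iff subset_iff) (metis scaleR_one scaleR_scaleR nonzero_divide_eq_eq nonzero_eq_divide_eq)+

lemma closure_scaleR_tvs:
  assumes "r \<noteq> 0"
  shows "closure ((\<lambda>x::'a::real_tvs. r *\<^sub>R x) ` A) = (\<lambda>x. r *\<^sub>R x) ` closure A"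
proof
  have "(\<lambda>x. (1 / r) *\<^sub>R x) ` closure ((\<lambda>x. r *\<^sub>R x) ` A) \<subseteq> closure A"
    using scaleR_closure_subset[of "1 / r" "(\<lambda>x. r *\<^sub>R x) ` A"] assms by (simp add: image_image)
  then show "closure ((\<lambda>x::'a. r *\<^sub>R x) ` A) \<subseteq> (\<lambda>x. r *\<^sub>R x) ` closure A"
    using assms scaleR_image_subset_iff[of "1 / r" "closure ((\<lambda>x. r *\<^sub>R x) ` A)" "closure A"] by simp
qed (rule scaleR_closure_subset)

text \<open>Convexity as an inclusion between sums of sets, so that it passes to the closure by the rules for
  closures of sums and multiples; a topological vector space has no norm to argue with.\<close>

lemma convex_iff_set_plus:
  "convex A \<longleftrightarrow>
    (\<forall>u\<ge>0. \<forall>v\<ge>0. u + v = 1 \<longrightarrow> (\<lambda>x. u *\<^sub>R x) ` A + (\<lambda>x. v *\<^sub>R x) ` A \<subseteq> A)"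
proof
  assume "convex A"
  then show "\<forall>u\<ge>0. \<forall>v\<ge>0. u + v = 1 \<longrightarrow> (\<lambda>x. u *\<^sub>R x) ` A + (\<lambda>x. v *\<^sub>R x) ` A \<subseteq> A"
    by (auto elim!: set_plus_elim simp: convex_def)
next
  assume *: "\<forall>u\<ge>0. \<forall>v\<ge>0. u + v = 1 \<longrightarrow> (\<lambda>x. u *\<^sub>R x) ` A + (\<lambda>x. v *\<^sub>R x) ` A \<subseteq> A"
  show "convex A"
    unfolding convex_def
  proof clarify
    fix x y and u v :: real
    assume "x \<in> A" "y \<in> A" "0 \<le> u" "0 \<le> v" "u + v = 1"
    then show "u *\<^sub>R x + v *\<^sub>R y \<in> A"
      using * by (meson image_eqI set_plus_intro subsetD)
  qed
qed

lemma scaleR_convex_add: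
  assumes "convex A" "0 < r" "0 < s"
  shows "(\<lambda>x. (r + s) *\<^sub>R x) ` A = (\<lambda>x. r *\<^sub>R x) ` A + (\<lambda>x. s *\<^sub>R x) ` A"
proof
  show "(\<lambda>x. (r + s) *\<^sub>R x) ` A \<subseteq> (\<lambda>x. r *\<^sub>R x) ` A + (\<lambda>x. s *\<^sub>R x) ` A"
    by (auto simp: scaleR_add_left)
  show "(\<lambda>x. r *\<^sub>R x) ` A + (\<lambda>x. s *\<^sub>R x) ` A \<subseteq> (\<lambda>x. (r + s) *\<^sub>R x) ` A"
  proof (clarsimp elim!: set_plus_elim)
    fix x y assume "x \<in> A" "y \<in> A"
    then have "(r / (r + s)) *\<^sub>R x + (s / (r + s)) *\<^sub>R y \<in> A"
      using assms by (intro convexD) (auto simp: add_divide_distrib[symmetric])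
    moreover have "r *\<^sub>R x + s *\<^sub>R y = (r + s) *\<^sub>R ((r / (r + s)) *\<^sub>R x + (s / (r + s)) *\<^sub>R y)"
      using assms by (simp add: scaleR_add_right)
    ultimately show "r *\<^sub>R x + s *\<^sub>R y \<in> (\<lambda>x. (r + s) *\<^sub>R x) ` A"
      by (rule rev_image_eqI)
  qed
qed

lemma convex_closure_tvs:
  fixes A :: "'a::real_tvs set"
  assumes "convex A"
  shows "convex (closure A)"
  unfolding convex_iff_set_plus
proof (intro allI impI)
  fix u v :: real
  assume "0 \<le> u" "0 \<le> v" "u + v = 1"
  then have "(\<lambda>x. u *\<^sub>R x) ` A + (\<lambda>x. v *\<^sub>R x) ` A \<subseteq> A"
    using assms convex_iff_set_plus by blast
  then have "closure ((\<lambda>x. u *\<^sub>R x) ` A + (\<lambda>x. v *\<^sub>R x) ` A) \<subseteq> closure A"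
    by (rule closure_mono)
  then show "(\<lambda>x. u *\<^sub>R x) ` closure A + (\<lambda>x. v *\<^sub>R x) ` closure A \<subseteq> closure A"
    using set_plus_mono2[OF scaleR_closure_subset scaleR_closure_subset] closure_add_subset
    by (meson order_trans)
qed

section \<open>Addition of closed sets\<close>

lemma cadd_eq: "A \<dotplus> B = closure (A + B)"
  unfolding cadd_def set_plus_def by (rule arg_cong[where f = closure]) auto

lemma cadd_commute: "A \<dotplus> B = B \<dotplus> A"
  by (simp add: cadd_eq add.commute)

lemma cadd_assoc: "A \<dotplus> B \<dotplus> C = A \<dotplus> (B \<dotplus> C)"
  using closure_add_closure[of "A + B" C] closure_add_closure[of "B + C" A]
  by (simp add: cadd_eq ac_simps)

lemma cadd_left_commute: "A \<dotplus> (B \<dotplus> C) = B \<dotplus> (A \<dotplus> C)"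
  by (metis cadd_assoc cadd_commute)

lemmas cadd_ac = cadd_assoc cadd_commute cadd_left_commute

lemma cadd_mono: "A \<subseteq> A' \<Longrightarrow> B \<subseteq> B' \<Longrightarrow> A \<dotplus> B \<subseteq> A' \<dotplus> B'"
  unfolding cadd_eq by (intro closure_mono set_plus_mono2)

lemma set_plus_subset_cadd: "A + B \<subseteq> A \<dotplus> B"
  unfolding cadd_eq by (rule closure_subset)

lemma closed_cadd: "closed (A \<dotplus> B)"
  by (simp add: cadd_eq)

lemma cadd_CC:
  assumes "A \<in> CC" "B \<in> CC"
  shows "A \<dotplus> B \<in> CC"
  using assms convex_closure_tvs[OF convex_set_plus[of A B]] unfolding CC_def cadd_eq
  by (auto simp: set_plus_def)

lemma scaleR_cadd:
  "r \<noteq> 0 \<Longrightarrow> (\<lambda>x. r *\<^sub>R x) ` (A \<dotplus> B) = (\<lambda>x. r *\<^sub>R x) ` A \<dotplus> (\<lambda>x. r *\<^sub>R x) ` B"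
  by (simp add: cadd_eq closure_scaleR_tvs[symmetric] scaleR_set_plus)

lemma scaleR_CC: "A \<in> CC \<Longrightarrow> r \<noteq> 0 \<Longrightarrow> (\<lambda>x. r *\<^sub>R x) ` A \<in> CC"
  unfolding CC_def by (auto simp: convex_scaling closure_scaleR_tvs simp flip: closure_eq)

text \<open>The space need not be Hausdorff, so \<open>{0}\<close> may fail to be closed; \<open>closure {0}\<close> is the smallest
  closed set that can serve as a trivial summand.\<close>

lemma closure_zero_CC: "closure {0} \<in> CC"
  by (simp add: CC_def convex_closure_tvs)

lemma cadd_closure_zero: "closed A \<Longrightarrow> A \<dotplus> closure {0} = A"
  unfolding cadd_eq by (metis add.commute closure_add_closure add_0_right closure_closed set_add_0)

lemma closure_zero_subset_nhds:
  fixes N :: "'a::real_tvs set"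
  assumes "0 \<in> interior N"
  shows "closure {0} \<subseteq> N"
proof
  fix x :: 'a assume "x \<in> closure {0}"
  then have "x \<in> {0} + interior N"
    using in_closure_iff_add_nhds assms open_interior by blast
  then show "x \<in> N"
    using interior_subset by (auto elim!: set_plus_elim)
qed

section \<open>Bounded sets\<close>

lemma scaleR_nhds:
  fixes N :: "'a::real_tvs set"
  assumes "0 \<in> interior N" "r \<noteq> 0"
  shows "0 \<in> interior ((\<lambda>x. r *\<^sub>R x) ` N)"
proof (rule interiorI)
  have eq: "(\<lambda>x. r *\<^sub>R x) ` interior N = (\<lambda>x. (1 / r) *\<^sub>R x) -` interior N"
    using assms(2) by (force simp: image_iff)
  show "open ((\<lambda>x. r *\<^sub>R x) ` interior N)"
    unfolding eq by (intro open_vimage open_interior continuous_on_scaleR_tvs)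
  show "0 \<in> (\<lambda>x. r *\<^sub>R x) ` interior N"
    using assms(1) by force
  show "(\<lambda>x. r *\<^sub>R x) ` interior N \<subseteq> (\<lambda>x. r *\<^sub>R x) ` N"
    by (intro image_mono interior_subset)
qed

lemma tvs_bounded_closure_zero: "tvs_bounded (closure {0})"
  unfolding tvs_bounded_def
  by (intro allI impI exI[of _ 1]) (simp add: closure_zero_subset_nhds scaleR_nhds)

lemma tvs_bounded_cadd:
  assumes "tvs_bounded D" "tvs_bounded E"
  shows "tvs_bounded (D \<dotplus> E)"
  unfolding tvs_bounded_def
proof (intro allI impI)
  fix N :: "'a set" assume "0 \<in> interior N"
  then obtain M where M: "open M" "0 \<in> M" "closure (M + M) \<subseteq> N"
    by (rule closure_add_nhds)
  obtain s1 s2 where s: "s1 > 0" "\<forall>t\<ge>s1. D \<subseteq> (\<lambda>x. t *\<^sub>R x) ` M"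
      "s2 > 0" "\<forall>t\<ge>s2. E \<subseteq> (\<lambda>x. t *\<^sub>R x) ` M"
    using assms M unfolding tvs_bounded_def by (metis interior_open)
  have "D \<dotplus> E \<subseteq> (\<lambda>x. t *\<^sub>R x) ` N" if t: "t \<ge> max s1 s2" for t
  proof -
    have "D \<dotplus> E \<subseteq> (\<lambda>x. t *\<^sub>R x) ` M \<dotplus> (\<lambda>x. t *\<^sub>R x) ` M"
      using s t by (intro cadd_mono) auto
    also have "\<dots> = (\<lambda>x. t *\<^sub>R x) ` (M \<dotplus> M)"
      using s t by (intro scaleR_cadd[symmetric]) auto
    finally show ?thesis
      using M(3) unfolding cadd_eq by blast
  qed
  then show "\<exists>s>0. \<forall>t\<ge>s. D \<dotplus> E \<subseteq> (\<lambda>x. t *\<^sub>R x) ` N"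
    using s by (intro exI[of _ "max s1 s2"]) auto
qed

lemma tvs_bounded_scaleR:
  assumes "tvs_bounded D" "r > 0"
  shows "tvs_bounded ((\<lambda>x. r *\<^sub>R x) ` D)"
  unfolding tvs_bounded_def
proof (intro allI impI)
  fix N :: "'a set" assume "0 \<in> interior N"
  then obtain s where s: "s > 0" "\<forall>t\<ge>s. D \<subseteq> (\<lambda>x. t *\<^sub>R x) ` N"
    using assms(1) unfolding tvs_bounded_def by blast
  have "(\<lambda>x. r *\<^sub>R x) ` D \<subseteq> (\<lambda>x. t *\<^sub>R x) ` N" if "t \<ge> r * s" for t
  proof -
    have "s \<le> t / r"
      using that assms(2) by (simp add: pos_le_divide_eq mult.commute)
    then have "D \<subseteq> (\<lambda>x. (t / r) *\<^sub>R x) ` N"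
      using s by blast
    then have "(\<lambda>x. r *\<^sub>R x) ` D \<subseteq> (\<lambda>x. r *\<^sub>R x) ` (\<lambda>x. (t / r) *\<^sub>R x) ` N"
      by (rule image_mono)
    then show ?thesis
      using assms(2) by (simp add: image_image)
  qed
  then show "\<exists>s>0. \<forall>t\<ge>s. (\<lambda>x. r *\<^sub>R x) ` D \<subseteq> (\<lambda>x. t *\<^sub>R x) ` N"
    using s assms(2) by (intro exI[of _ "r * s"]) auto
qed

lemma tvs_bounded_small_multiples:
  assumes "tvs_bounded D" "0 \<in> interior N"
  obtains e where "e > 0" "\<And>t. 0 < t \<Longrightarrow> t \<le> e \<Longrightarrow> (\<lambda>x. t *\<^sub>R x) ` D \<subseteq> N"
proof -
  obtain s where s: "s > 0" "\<forall>t\<ge>s. D \<subseteq> (\<lambda>x. t *\<^sub>R x) ` N"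
    using assms unfolding tvs_bounded_def by blast
  show ?thesis
  proof (rule that[of "1 / s"])
    fix t :: real assume t: "0 < t" "t \<le> 1 / s"
    then have "D \<subseteq> (\<lambda>x. (1 / t) *\<^sub>R x) ` N"
      using s by (simp add: field_simps)
    then show "(\<lambda>x. t *\<^sub>R x) ` D \<subseteq> N"
      using t by (simp add: scaleR_image_subset_iff)
  qed (use s in simp)
qed

lemma BCC_cadd: "D \<in> BCC \<Longrightarrow> E \<in> BCC \<Longrightarrow> D \<dotplus> E \<in> BCC"
  by (simp add: BCC_def cadd_CC tvs_bounded_cadd)

lemma BCC_scaleR: "D \<in> BCC \<Longrightarrow> r > 0 \<Longrightarrow> (\<lambda>x. r *\<^sub>R x) ` D \<in> BCC"
  by (simp add: BCC_def scaleR_CC tvs_bounded_scaleR)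

text \<open>The limit argument behind both the absorption of the cone and the cancellation law: the vectors
  \<open>c / n\<close> and the sets \<open>D / n\<close> tend to the origin, the latter uniformly since \<open>D\<close> is bounded.\<close>

lemma in_closure_if_perturbed:
  fixes a c :: "'a::real_tvs"
  assumes D: "tvs_bounded D"
    and *: "\<And>n. n \<ge> 1 \<Longrightarrow>
      a + (1 / real n) *\<^sub>R c \<in> closure (B + (\<lambda>x. (1 / real n) *\<^sub>R x) ` D)"
  shows "a \<in> closure B"
  unfolding in_closure_iff_add_nhds
proof (intro allI impI)
  fix N :: "'a set" assume "open N" "0 \<in> N"
  then obtain M where M: "open M" "0 \<in> M" "M + M + M \<subseteq> N"
    using open_nhds_third[of N] by (auto simp: interior_open)
  obtain e where e: "e > 0" "\<And>t. 0 < t \<Longrightarrow> t \<le> e \<Longrightarrow> (\<lambda>x. t *\<^sub>R x) ` D \<subseteq> M"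
    using tvs_bounded_small_multiples[OF D, of M] M by (auto simp: interior_open)
  have lim: "((\<lambda>n. 1 / real n) \<longlongrightarrow> 0) sequentially"
    by (rule lim_1_over_n)
  have "\<forall>\<^sub>F n in sequentially. (1 / real n) *\<^sub>R (- c) \<in> M"
    using filterlim_iff[THEN iffD1, OF lim] eventually_scaleR_small[OF M(1,2), of "- c"]
    by blast
  moreover have "\<forall>\<^sub>F n in sequentially. 1 / real n < e"
    using order_tendstoD(2)[OF lim e(1)] .
  ultimately have "\<forall>\<^sub>F n in sequentially. (1 / real n) *\<^sub>R (- c) \<in> M \<and> 1 / real n < e \<and> n \<ge> 1"
    using eventually_ge_at_top[of 1] by eventually_elim auto
  then obtain n where n: "(1 / real n) *\<^sub>R (- c) \<in> M" "1 / real n < e" "n \<ge> 1"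
    using eventually_happens'[OF sequentially_bot] by blast
  have "a + (1 / real n) *\<^sub>R c \<in> (B + (\<lambda>x. (1 / real n) *\<^sub>R x) ` D) + M"
    using *[OF n(3)] M in_closure_iff_add_nhds by blast
  moreover have "(\<lambda>x. (1 / real n) *\<^sub>R x) ` D \<subseteq> M"
    using e(2)[of "1 / real n"] n by simp
  ultimately have "a + (1 / real n) *\<^sub>R c \<in> (B + M) + M"
    by (meson order_refl set_plus_mono2 subsetD)
  then have "(a + (1 / real n) *\<^sub>R c) + (1 / real n) *\<^sub>R (- c) \<in> (B + M) + M + M"
    using n(1) by (rule set_plus_intro)
  then have "a \<in> B + (M + M + M)"
    by (simp add: add.assoc)
  then show "a \<in> B + N"
    using M(3) by (meson order_refl set_plus_mono2 subsetD)
qed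

section \<open>Absorption and cancellation\<close>

locale closed_convex_cone =
  fixes V :: "'a::real_tvs set"
  assumes closed_V: "closed V" and convex_cone_V: "convex_cone V"
begin

lemma zero_in_V: "0 \<in> V"
  using convex_cone_V by (simp add: convex_cone_contains_0)

lemma V_plus_V: "V + V = V"
proof
  show "V + V \<subseteq> V"
    using convex_cone_add[OF convex_cone_V] by (auto elim!: set_plus_elim)
  show "V \<subseteq> V + V"
    by (rule set_zero_plus2[OF zero_in_V])
qed

lemma scaleR_V_subset: "r \<ge> 0 \<Longrightarrow> (\<lambda>x. r *\<^sub>R x) ` V \<subseteq> V"
  using convex_cone_scaleR[OF convex_cone_V] by auto

lemma scaleR_V: "r > 0 \<Longrightarrow> (\<lambda>x. r *\<^sub>R x) ` V = V"
  using scaleR_V_subset[of r] scaleR_V_subset[of "1 / r"]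
    scaleR_image_subset_iff[of "1 / r" V V] by (intro equalityI) simp_all

lemma V_CC: "V \<in> CC"
  using closed_V convex_cone_V by (simp add: CC_def convex_cone_def)

lemma cadd_V_V: "V \<dotplus> V = V"
  using closed_V by (simp add: cadd_eq V_plus_V)

text \<open>The cone lies in the recession cone of every closed convex set \<open>A\<close> from which it has bounded
  distance. For \<open>v \<in> V\<close> the multiple \<open>n v\<close> is close to some \<open>a + d\<close> with \<open>a \<in> A\<close> and \<open>d \<in> D\<close>, so for
  \<open>x \<in> A\<close> the point \<open>(1 - 1/n) x + v\<close> is close to the convex combination \<open>(1 - 1/n) x + a/n\<close> of
  points of \<open>A\<close>, up to the error \<open>d/n\<close>; letting \<open>n\<close> grow gives \<open>x + v \<in> A\<close>.\<close>

lemma cadd_V_absorb: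
  assumes A: "A \<in> CC" and D: "tvs_bounded D" and V: "V \<subseteq> A \<dotplus> D"
  shows "A \<dotplus> V = A"
proof
  show "A \<dotplus> V \<subseteq> A"
    unfolding cadd_eq
  proof (rule closure_minimal)
    show "closed A" using A by (simp add: CC_def)
    show "A + V \<subseteq> A"
    proof (clarify elim!: set_plus_elim)
      fix x v assume "x \<in> A" "v \<in> V"
      have "(x + v) + (1 / real n) *\<^sub>R (- x) \<in> closure (A + (\<lambda>y. (1 / real n) *\<^sub>R y) ` D)"
        if n: "n \<ge> 1" for n
      proof -
        let ?t = "1 / real n"
        have t: "0 < ?t" "?t \<le> 1" using n by auto
        have "real n *\<^sub>R v \<in> A \<dotplus> D"
          using \<open>v \<in> V\<close> scaleR_V_subset[of "real n"] V by auto
        then have "?t *\<^sub>R (real n *\<^sub>R v) \<in> (\<lambda>y. ?t *\<^sub>R y) ` (A \<dotplus> D)"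
          by (rule imageI)
        then have v: "v \<in> closure ((\<lambda>y. ?t *\<^sub>R y) ` A + (\<lambda>y. ?t *\<^sub>R y) ` D)"
          using n by (simp add: scaleR_cadd) (simp add: cadd_eq)
        have "(1 - ?t) *\<^sub>R x \<in> closure ((\<lambda>y. (1 - ?t) *\<^sub>R y) ` A)"
          using \<open>x \<in> A\<close> by (intro closure_subset[THEN subsetD] imageI)
        then have "(1 - ?t) *\<^sub>R x + v \<in>
            closure ((\<lambda>y. (1 - ?t) *\<^sub>R y) ` A + ((\<lambda>y. ?t *\<^sub>R y) ` A + (\<lambda>y. ?t *\<^sub>R y) ` D))"
          by (rule closure_add_subset[THEN subsetD, OF set_plus_intro, OF _ v])
        moreover have "(\<lambda>y. (1 - ?t) *\<^sub>R y) ` A + (\<lambda>y. ?t *\<^sub>R y) ` A \<subseteq> A"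
          using A t convex_iff_set_plus[of A] by (simp add: CC_def)
        then have "(\<lambda>y. (1 - ?t) *\<^sub>R y) ` A + ((\<lambda>y. ?t *\<^sub>R y) ` A + (\<lambda>y. ?t *\<^sub>R y) ` D)
            \<subseteq> A + (\<lambda>y. ?t *\<^sub>R y) ` D"
          unfolding add.assoc[symmetric] by (intro set_plus_mono2 order_refl)
        ultimately have "(1 - ?t) *\<^sub>R x + v \<in> closure (A + (\<lambda>y. ?t *\<^sub>R y) ` D)"
          by (meson closure_mono subsetD)
        then show ?thesis
          by (simp add: algebra_simps)
      qed
      then have "x + v \<in> closure A"
        by (rule in_closure_if_perturbed[OF D])
      then show "x + v \<in> A"
        using \<open>closed A\<close> by simp
    qed
  qed
  show "A \<subseteq> A \<dotplus> V"
    using set_plus_subset_cadd[of V A] set_zero_plus2[OF zero_in_V, of A]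
    unfolding cadd_commute[of V] by (rule subset_trans[rotated])
qed

text \<open>The order cancellation law. Applying the inclusion \<open>n\<close> times to a point \<open>a\<close> of \<open>A\<close> gives
  \<open>n a + C \<subseteq> closure (n B + C)\<close>. Here \<open>C\<close> may be unbounded, but its unbounded part lies in \<open>V\<close> and
  is absorbed by \<open>n B\<close>, which leaves \<open>n a + c \<in> closure (n B + D)\<close> with \<open>D\<close> bounded; dividing by
  \<open>n\<close> and letting \<open>n\<close> grow removes \<open>c\<close> and \<open>D\<close>.\<close>

lemma subset_if_cadd_subset:
  assumes B: "B \<in> CC" "B \<dotplus> V = B"
    and C: "C \<noteq> {}" "C \<subseteq> V \<dotplus> D" and D: "tvs_bounded D"
    and sub: "A \<dotplus> C \<subseteq> B \<dotplus> C"
  shows "A \<subseteq> B"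
proof
  fix a assume "a \<in> A"
  obtain c where "c \<in> C" using C by blast
  have iter: "{real n *\<^sub>R a} + C \<subseteq> (\<lambda>x. real n *\<^sub>R x) ` B \<dotplus> C" if "n \<ge> 1" for n
    using that
  proof (induction n rule: dec_induct)
    case base
    have "{a} + C \<subseteq> A + C"
      using \<open>a \<in> A\<close> by (intro set_plus_mono2) auto
    then show ?case
      using sub set_plus_subset_cadd[of A C] by simp
  next
    case (step n)
    let ?nB = "(\<lambda>x. real n *\<^sub>R x) ` B"
    have "{real (Suc n) *\<^sub>R a} = {real n *\<^sub>R a} + {a}"
      by (auto simp: set_plus_def algebra_simps)
    then have "{real (Suc n) *\<^sub>R a} + C = {real n *\<^sub>R a} + ({a} + C)"
      by (simp add: add.assoc)
    also have "\<dots> \<subseteq> {real n *\<^sub>R a} \<dotplus> (A \<dotplus> C)"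
    proof (rule order_trans[OF set_plus_mono2[OF order_refl] set_plus_subset_cadd])
      show "{a} + C \<subseteq> A \<dotplus> C"
        using \<open>a \<in> A\<close> by (intro order_trans[OF set_plus_mono2 set_plus_subset_cadd]) auto
    qed
    also have "\<dots> \<subseteq> {real n *\<^sub>R a} \<dotplus> (B \<dotplus> C)"
      by (intro cadd_mono sub order_refl)
    also have "\<dots> = B \<dotplus> closure ({real n *\<^sub>R a} + C)"
      unfolding cadd_left_commute[of "{real n *\<^sub>R a}"] by (simp only: cadd_eq[of "{real n *\<^sub>R a}"])
    also have "\<dots> \<subseteq> B \<dotplus> (?nB \<dotplus> C)"
      using step.IH by (intro cadd_mono closure_minimal closed_cadd order_refl)
    also have "\<dots> = (?nB + B) \<dotplus> C"
        using closure_add_closure[of "?nB + C" B] by (simp add: cadd_eq ac_simps)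
    \<comment> \<open>convexity of \<open>B\<close> turns the sum of multiples into one multiple\<close>
    also have "?nB + B = (\<lambda>x. real (Suc n) *\<^sub>R x) ` B"
      using scaleR_convex_add[of B "real n" 1] B step.hyps
      by (simp add: CC_def add.commute)
    finally show ?case .
  qed
  have "a + (1 / real n) *\<^sub>R c \<in> closure (B + (\<lambda>x. (1 / real n) *\<^sub>R x) ` D)" if n: "n \<ge> 1" for n
  proof -
    let ?nB = "(\<lambda>x. real n *\<^sub>R x) ` B"
    have "real n *\<^sub>R a + c \<in> ?nB \<dotplus> C"
      using iter[OF n] \<open>c \<in> C\<close> by auto
    also have "\<dots> \<subseteq> ?nB \<dotplus> (V \<dotplus> D)"
      by (intro cadd_mono C order_refl)
    also have "\<dots> = (\<lambda>x. real n *\<^sub>R x) ` (B \<dotplus> V) \<dotplus> D"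
      using n by (simp add: cadd_assoc scaleR_cadd scaleR_V)
    finally have "real n *\<^sub>R a + c \<in> ?nB \<dotplus> D"
      by (simp add: B)
    then have "(1 / real n) *\<^sub>R (real n *\<^sub>R a + c) \<in> (\<lambda>x. (1 / real n) *\<^sub>R x) ` (?nB \<dotplus> D)"
      by (rule imageI)
    then show ?thesis
      using n by (simp add: scaleR_cadd image_image scaleR_add_right) (simp add: cadd_eq)
  qed
  then have "a \<in> closure B"
    by (rule in_closure_if_perturbed[OF D])
  then show "a \<in> B"
    using B by (simp add: CC_def)
qed

lemma CV_CC: "A \<in> CV V \<Longrightarrow> A \<in> CC"
  by (simp add: CV_def)

lemma CV_closed: "A \<in> CV V \<Longrightarrow> closed A"
  using CV_CC by (simp add: CC_def)

lemma CV_E: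
  assumes "A \<in> CV V"
  obtains D where "D \<in> BCC" "A \<subseteq> V \<dotplus> D" "V \<subseteq> A \<dotplus> D"
  using assms unfolding CV_def by blast

lemma CV_cadd_V [simp]:
  assumes "A \<in> CV V"
  shows "A \<dotplus> V = A"
  using assms
proof (rule CV_E)
  fix D assume "D \<in> BCC" "V \<subseteq> A \<dotplus> D"
  then show ?thesis
    using cadd_V_absorb[of A D] CV_CC[OF assms] by (simp add: BCC_def)
qed

lemma CV_V_cadd [simp]: "A \<in> CV V \<Longrightarrow> V \<dotplus> A = A"
  by (simp add: cadd_commute[of V])

lemma CV_cadd_subset_cancel:
  assumes "B \<in> CC" "B \<dotplus> V = B" "C \<in> CV V" "A \<dotplus> C \<subseteq> B \<dotplus> C"
  shows "A \<subseteq> B"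
  using assms(3)
proof (rule CV_E)
  fix D assume "D \<in> BCC" "C \<subseteq> V \<dotplus> D"
  then show ?thesis
    using CV_CC[OF assms(3)] subset_if_cadd_subset[OF assms(1,2) _ \<open>C \<subseteq> V \<dotplus> D\<close> _ assms(4)]
    by (simp add: BCC_def CC_def)
qed

lemma CV_cadd_cancel:
  assumes "A \<in> CV V" "B \<in> CV V" "C \<in> CV V"
  shows "A \<dotplus> C = B \<dotplus> C \<longleftrightarrow> A = B"
  using assms CV_cadd_subset_cancel[of B C A] CV_cadd_subset_cancel[of A C B]
  by (auto simp: CV_CC)

section \<open>The abstract convex cone\<close>

lemma V_CV [simp]: "V \<in> CV V"
proof -
  have "closure {0} \<in> BCC"
    by (simp add: BCC_def closure_zero_CC tvs_bounded_closure_zero)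
  then show ?thesis
    unfolding CV_def using V_CC cadd_closure_zero[OF closed_V] by blast
qed

lemma CV_cadd [simp]:
  assumes "A \<in> CV V" "B \<in> CV V"
  shows "A \<dotplus> B \<in> CV V"
proof -
  obtain D where D: "D \<in> BCC" "A \<subseteq> V \<dotplus> D" "V \<subseteq> A \<dotplus> D"
    using CV_E[OF assms(1)] .
  obtain E where E: "E \<in> BCC" "B \<subseteq> V \<dotplus> E" "V \<subseteq> B \<dotplus> E"
    using CV_E[OF assms(2)] .
  have "A \<dotplus> B \<subseteq> (V \<dotplus> D) \<dotplus> (V \<dotplus> E)"
    using D E by (intro cadd_mono)
  also have "\<dots> = (V \<dotplus> V) \<dotplus> (D \<dotplus> E)"
    by (simp only: cadd_ac)
  also have "\<dots> = V \<dotplus> (D \<dotplus> E)"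
    by (simp add: cadd_V_V)
  finally have 1: "A \<dotplus> B \<subseteq> V \<dotplus> (D \<dotplus> E)" .
  have "V \<dotplus> V \<subseteq> (A \<dotplus> D) \<dotplus> (B \<dotplus> E)"
    using D E by (intro cadd_mono)
  also have "\<dots> = (A \<dotplus> B) \<dotplus> (D \<dotplus> E)"
    by (simp only: cadd_ac)
  finally have 2: "V \<subseteq> (A \<dotplus> B) \<dotplus> (D \<dotplus> E)"
    by (simp add: cadd_V_V)
  show ?thesis
    unfolding CV_def using 1 2 cadd_CC[OF CV_CC CV_CC] BCC_cadd[OF D(1) E(1)] assms by blast
qed

lemma CV_scaleR:
  assumes "A \<in> CV V" "r > 0"
  shows "(\<lambda>x. r *\<^sub>R x) ` A \<in> CV V"
proof -
  obtain D where D: "D \<in> BCC" "A \<subseteq> V \<dotplus> D" "V \<subseteq> A \<dotplus> D"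
    using CV_E[OF assms(1)] .
  have "(\<lambda>x. r *\<^sub>R x) ` A \<subseteq> (\<lambda>x. r *\<^sub>R x) ` (V \<dotplus> D)"
    "(\<lambda>x. r *\<^sub>R x) ` V \<subseteq> (\<lambda>x. r *\<^sub>R x) ` (A \<dotplus> D)"
    using D by (auto intro!: image_mono)
  then have "(\<lambda>x. r *\<^sub>R x) ` A \<subseteq> V \<dotplus> (\<lambda>x. r *\<^sub>R x) ` D"
    "V \<subseteq> (\<lambda>x. r *\<^sub>R x) ` A \<dotplus> (\<lambda>x. r *\<^sub>R x) ` D"
    using assms(2) by (simp_all add: scaleR_cadd scaleR_V)
  then show ?thesis
    unfolding CV_def using BCC_scaleR[OF D(1) assms(2)] scaleR_CC[OF CV_CC[OF assms(1)]] assms(2)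
    by auto
qed

lemma CV_cmul [simp]: "A \<in> CV V \<Longrightarrow> r \<ge> 0 \<Longrightarrow> cmul V r A \<in> CV V"
  by (auto simp: cmul_def CV_scaleR)

lemma cmul_zero: "cmul V 0 A = V"
  by (simp add: cmul_def)

lemma cmul_one: "cmul V 1 A = A"
  by (simp add: cmul_def)

lemma cmul_cadd: "r \<ge> 0 \<Longrightarrow> cmul V r (A \<dotplus> B) = cmul V r A \<dotplus> cmul V r B"
  by (simp add: cmul_def cadd_V_V scaleR_cadd)

lemma cmul_cmul: "r \<ge> 0 \<Longrightarrow> s \<ge> 0 \<Longrightarrow> cmul V r (cmul V s A) = cmul V (r * s) A"
  by (auto simp: cmul_def image_image scaleR_V)

lemma cmul_add:
  assumes A: "A \<in> CV V" and "r \<ge> 0" "s \<ge> 0"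
  shows "cmul V (r + s) A = cmul V r A \<dotplus> cmul V s A"
proof (cases "r = 0 \<or> s = 0")
  case True
  then show ?thesis
    using assms CV_cmul[of A r] CV_cmul[of A s] by (auto simp: cmul_zero)
next
  case False
  then have pos: "r > 0" "s > 0" using assms by auto
  moreover have "closed ((\<lambda>x. (r + s) *\<^sub>R x) ` A)"
    using pos CV_scaleR[OF A, of "r + s"] CV_closed by simp
  moreover have "convex A" using CV_CC[OF A] by (simp add: CC_def)
  ultimately show ?thesis
    by (simp add: cmul_def cadd_eq scaleR_convex_add[symmetric])
qed

lemma abstract_convex_cone_CV: "abstract_convex_cone (CV V) (\<dotplus>) V (cmul V)"
  by unfold_locales
    (simp_all add: cadd_ac cmul_zero cmul_one cmul_cadd cmul_cmul cmul_add)

section \<open>Uniformly close sets\<close>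

lemma near_refl: "closed A \<Longrightarrow> 0 \<in> interior U \<Longrightarrow> near U A A"
  unfolding near_def
  by (intro bexI[of _ "closure {0}"]) (auto simp: cadd_closure_zero closure_zero_subset_nhds closure_zero_CC)

lemma near_sym: "near U A B \<Longrightarrow> near U B A"
  unfolding near_def by blast

lemma near_cadd:
  assumes "near U A B" "near U C D" "closure (U + U) \<subseteq> U'"
  shows "near U' (A \<dotplus> C) (B \<dotplus> D)"
proof -
  obtain K where K: "K \<in> CC" "K \<subseteq> U" "A \<subseteq> B \<dotplus> K" "B \<subseteq> A \<dotplus> K"
    using assms(1) by (auto simp: near_def)
  obtain L where L: "L \<in> CC" "L \<subseteq> U" "C \<subseteq> D \<dotplus> L" "D \<subseteq> C \<dotplus> L"
    using assms(2) by (auto simp: near_def)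
  have "A \<dotplus> C \<subseteq> (B \<dotplus> K) \<dotplus> (D \<dotplus> L)" "B \<dotplus> D \<subseteq> (A \<dotplus> K) \<dotplus> (C \<dotplus> L)"
    by (intro cadd_mono K L)+
  moreover have "K \<dotplus> L \<subseteq> U'"
    using cadd_mono[OF K(2) L(2)] assms(3) by (simp add: cadd_eq)
  ultimately show ?thesis
    unfolding near_def using K L
    by (intro bexI[of _ "K \<dotplus> L"]) (auto simp: cadd_ac cadd_CC)
qed

text \<open>Closeness is translation invariant. The set \<open>K\<close> witnessing it may be unbounded; cancellation of \<open>C\<close>
  still applies because \<open>Q \<dotplus> K\<close> absorbs \<open>V\<close> as soon as \<open>Q\<close> does.\<close>

lemma near_cadd_cancel:
  assumes "A \<in> CV V" "B \<in> CV V" "C \<in> CV V"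
  shows "near U (A \<dotplus> C) (B \<dotplus> C) \<longleftrightarrow> near U A B"
proof -
  have cancel: "P \<dotplus> C \<subseteq> Q \<dotplus> C \<dotplus> K \<longleftrightarrow> P \<subseteq> Q \<dotplus> K"
    if "P \<in> CV V" "Q \<in> CV V" "K \<in> CC" for P Q K
  proof
    have eq: "Q \<dotplus> C \<dotplus> K = Q \<dotplus> K \<dotplus> C" by (simp add: cadd_ac)
    show "P \<subseteq> Q \<dotplus> K \<Longrightarrow> P \<dotplus> C \<subseteq> Q \<dotplus> C \<dotplus> K"
      unfolding eq by (intro cadd_mono order_refl)
    have "Q \<dotplus> K \<dotplus> V = Q \<dotplus> V \<dotplus> K" by (simp add: cadd_ac)
    then have "Q \<dotplus> K \<dotplus> V = Q \<dotplus> K"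
      using that by simp
    then show "P \<dotplus> C \<subseteq> Q \<dotplus> C \<dotplus> K \<Longrightarrow> P \<subseteq> Q \<dotplus> K"
      unfolding eq using CV_cadd_subset_cancel[of "Q \<dotplus> K" C P] that assms(3)
      by (simp add: cadd_CC CV_CC)
  qed
  show ?thesis
    unfolding near_def using cancel assms by auto
qed

lemma near_scaleR:
  assumes "near U A B" "r > 0" "(\<lambda>x. r *\<^sub>R x) ` U \<subseteq> U'"
  shows "near U' (cmul V r A) (cmul V r B)"
proof -
  obtain K where K: "K \<in> CC" "K \<subseteq> U" "A \<subseteq> B \<dotplus> K" "B \<subseteq> A \<dotplus> K"
    using assms(1) by (auto simp: near_def)
  have "(\<lambda>x. r *\<^sub>R x) ` A \<subseteq> (\<lambda>x. r *\<^sub>R x) ` (B \<dotplus> K)"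
    "(\<lambda>x. r *\<^sub>R x) ` B \<subseteq> (\<lambda>x. r *\<^sub>R x) ` (A \<dotplus> K)"
    using K by (auto intro!: image_mono)
  moreover have "(\<lambda>x. r *\<^sub>R x) ` K \<subseteq> U'"
    using K(2) assms(3) by blast
  ultimately show ?thesis
    unfolding near_def using K(1) assms(2)
    by (intro bexI[of _ "(\<lambda>x. r *\<^sub>R x) ` K"]) (simp_all add: scaleR_cadd cmul_def scaleR_CC)
qed

text \<open>Any two members of \<open>CV V\<close> differ by a bounded set in both directions. With the sum \<open>D \<dotplus> E\<close> of the
  two bounds one set serves for both inclusions; this avoids a convex hull of bounded sets, which need
  not be bounded when the space is not locally convex.\<close>

lemma near_small_multiples:
  assumes A: "A \<in> CV V" and B: "B \<in> CV V" and U: "0 \<in> interior U"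
  obtains e where "e > 0" "\<And>t. 0 \<le> t \<Longrightarrow> t < e \<Longrightarrow> near U (cmul V t A) (cmul V t B)"
proof -
  obtain D where D: "D \<in> BCC" "A \<subseteq> V \<dotplus> D" "V \<subseteq> A \<dotplus> D"
    using CV_E[OF assms(1)] .
  obtain E where E: "E \<in> BCC" "B \<subseteq> V \<dotplus> E" "V \<subseteq> B \<dotplus> E"
    using CV_E[OF assms(2)] .
  have "A \<subseteq> B \<dotplus> (D \<dotplus> E)"
    using D(2) cadd_mono[OF E(3), of D D] by (simp add: cadd_ac)
  moreover have "B \<subseteq> A \<dotplus> (D \<dotplus> E)"
    using E(2) cadd_mono[OF D(3), of E E] by (simp add: cadd_ac)
  ultimately have near: "near (D \<dotplus> E) A B"
    unfolding near_def using D E by (intro bexI[of _ "D \<dotplus> E"]) (auto simp: BCC_def cadd_CC)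
  obtain e where e: "e > 0" "\<And>t. 0 < t \<Longrightarrow> t \<le> e \<Longrightarrow> (\<lambda>x. t *\<^sub>R x) ` (D \<dotplus> E) \<subseteq> U"
    using tvs_bounded_small_multiples[of "D \<dotplus> E" U] BCC_cadd[OF D(1) E(1)] U
    by (auto simp: BCC_def)
  show ?thesis
  proof (rule that[OF e(1)])
    fix t :: real assume t: "0 \<le> t" "t < e"
    show "near U (cmul V t A) (cmul V t B)"
    proof (cases "t = 0")
      case True
      then show ?thesis by (simp add: cmul_zero near_refl closed_V U)
    next
      case False
      then show ?thesis using near_scaleR[OF near] e(2) t by simp
    qed
  qed
qed

end

section \<open>The vector space of pairs\<close>

context closed_convex_cone
begin

text \<open>Transitivity is the point where cancellation enters.\<close>

lemma equiv_mrh_rel: "equiv (CV V \<times> CV V) (mrh_rel V)"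
proof (rule equivI)
  show "mrh_rel V \<subseteq> (CV V \<times> CV V) \<times> (CV V \<times> CV V)"
    by (auto simp: mrh_rel_def)
  show "refl_on (CV V \<times> CV V) (mrh_rel V)"
    by (auto simp: refl_on_def mrh_rel_def cadd_commute)
  show "sym (mrh_rel V)"
    by (auto simp: sym_def mrh_rel_def cadd_commute)
  show "trans (mrh_rel V)"
  proof (rule transI)
    fix p q r assume "(p, q) \<in> mrh_rel V" "(q, r) \<in> mrh_rel V"
    then obtain A B C D E F where *: "p = (A, B)" "q = (C, D)" "r = (E, F)"
      "A \<in> CV V" "B \<in> CV V" "C \<in> CV V" "D \<in> CV V" "E \<in> CV V" "F \<in> CV V"
      "A \<dotplus> D = B \<dotplus> C" "C \<dotplus> F = D \<dotplus> E"
      by (auto simp: mrh_rel_def)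
    have "A \<dotplus> F \<dotplus> D = (A \<dotplus> D) \<dotplus> F" by (simp only: cadd_ac)
    also have "\<dots> = B \<dotplus> (C \<dotplus> F)" by (simp only: * cadd_assoc)
    also have "\<dots> = B \<dotplus> E \<dotplus> D" by (simp only: * cadd_ac)
    finally show "(p, r) \<in> mrh_rel V"
      using * CV_cadd_cancel[of "A \<dotplus> F" "B \<dotplus> E" D] by (simp add: mrh_rel_def)
  qed
qed

lemma mrh_class_eq_iff:
  assumes "A \<in> CV V" "B \<in> CV V" "C \<in> CV V" "D \<in> CV V"
  shows "mrh_class V A B = mrh_class V C D \<longleftrightarrow> A \<dotplus> D = B \<dotplus> C"
  using assms eq_equiv_class_iff[OF equiv_mrh_rel, of "(A, B)" "(C, D)"]
  by (simp add: mrh_class_def mrh_rel_def)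

lemma mem_mrh_class:
  "(C, D) \<in> mrh_class V A B \<longleftrightarrow>
    A \<in> CV V \<and> B \<in> CV V \<and> C \<in> CV V \<and> D \<in> CV V \<and> A \<dotplus> D = B \<dotplus> C"
  by (simp add: mrh_class_def mrh_rel_def)

lemma mrh_class_mrh [simp]: "A \<in> CV V \<Longrightarrow> B \<in> CV V \<Longrightarrow> mrh_class V A B \<in> mrh V"
  unfolding mrh_def mrh_class_def by (rule quotientI) simp

lemma mrh_E:
  assumes "p \<in> mrh V"
  obtains A B where "A \<in> CV V" "B \<in> CV V" "p = mrh_class V A B"
  using assms unfolding mrh_def mrh_class_def by (auto elim!: quotientE)

lemma mrh_class_self: "A \<in> CV V \<Longrightarrow> B \<in> CV V \<Longrightarrow> (A, B) \<in> mrh_class V A B"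
  by (simp add: mem_mrh_class cadd_commute)

lemma mrh_add_class:
  assumes CV: "A \<in> CV V" "B \<in> CV V" "C \<in> CV V" "D \<in> CV V"
  shows "mrh_add V (mrh_class V A B) (mrh_class V C D) = mrh_class V (A \<dotplus> C) (B \<dotplus> D)"
proof -
  have eq: "mrh_class V (A' \<dotplus> C') (B' \<dotplus> D') = mrh_class V (A \<dotplus> C) (B \<dotplus> D)"
    if "(A', B') \<in> mrh_class V A B" "(C', D') \<in> mrh_class V C D" for A' B' C' D'
  proof -
    have *: "A' \<in> CV V" "B' \<in> CV V" "C' \<in> CV V" "D' \<in> CV V"
      "A \<dotplus> B' = B \<dotplus> A'" "C \<dotplus> D' = D \<dotplus> C'"
      using that by (auto simp: mem_mrh_class)
    have "(A' \<dotplus> C') \<dotplus> (B \<dotplus> D) = (B \<dotplus> A') \<dotplus> (D \<dotplus> C')" by (simp only: cadd_ac)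
    also have "\<dots> = (A \<dotplus> B') \<dotplus> (C \<dotplus> D')" by (simp only: *)
    also have "\<dots> = (B' \<dotplus> D') \<dotplus> (A \<dotplus> C)" by (simp only: cadd_ac)
    finally show ?thesis
      using * CV by (simp add: mrh_class_eq_iff)
  qed
  have "mrh_add V (mrh_class V A B) (mrh_class V C D) \<subseteq> mrh_class V (A \<dotplus> C) (B \<dotplus> D)"
    unfolding mrh_add_def using eq by auto
  moreover have "mrh_class V (A \<dotplus> C) (B \<dotplus> D) \<subseteq> mrh_add V (mrh_class V A B) (mrh_class V C D)"
    unfolding mrh_add_def using mrh_class_self CV by blast
  ultimately show ?thesis by (rule equalityI)
qed

lemma mrh_scale_class:
  assumes CV: "A \<in> CV V" "B \<in> CV V"
  shows "mrh_scale V r (mrh_class V A B) =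
    (if r \<ge> 0 then mrh_class V (cmul V r A) (cmul V r B)
     else mrh_class V (cmul V (- r) B) (cmul V (- r) A))"
    (is "_ = ?F A B")
proof -
  have eq: "?F A' B' = ?F A B" if "(A', B') \<in> mrh_class V A B" for A' B'
  proof -
    have *: "A' \<in> CV V" "B' \<in> CV V" "B \<dotplus> A' = A \<dotplus> B'"
      using that by (auto simp: mem_mrh_class)
    have "cmul V s (B \<dotplus> A') = cmul V s (A \<dotplus> B')" for s
      by (simp only: *)
    then have "cmul V s B \<dotplus> cmul V s A' = cmul V s A \<dotplus> cmul V s B'" if "s \<ge> 0" for s
      using that by (metis cmul_cadd)
    from this[of r] this[of "- r"] show ?thesis
      using * CV by (auto simp: mrh_class_eq_iff cadd_commute)
  qed
  have "mrh_scale V r (mrh_class V A B) \<subseteq> ?F A B"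
    unfolding mrh_scale_def using eq by blast
  moreover have "?F A B \<subseteq> mrh_scale V r (mrh_class V A B)"
    unfolding mrh_scale_def using mrh_class_self CV by blast
  ultimately show ?thesis by (rule equalityI)
qed

text \<open>One formula for both signs: a scalar may be written as any difference of nonnegative numbers.
  With it the vector space axioms become identities in the cone, without distinguishing the signs
  of the scalars and of their sums.\<close>

lemma mrh_scale_diff_class:
  assumes CV: "A \<in> CV V" "B \<in> CV V" and "a \<ge> 0" "b \<ge> 0"
  shows "mrh_scale V (a - b) (mrh_class V A B) =
    mrh_class V (cmul V a A \<dotplus> cmul V b B) (cmul V a B \<dotplus> cmul V b A)"
proof (cases "a \<ge> b")
  case True
  then have "cmul V a C = cmul V (a - b) C \<dotplus> cmul V b C" if "C \<in> CV V" for C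
    using cmul_add[OF that, of "a - b" b] assms by simp
  then show ?thesis
    using True assms by (simp add: mrh_scale_class mrh_class_eq_iff cadd_ac)
next
  case False
  then have "cmul V b C = cmul V (b - a) C \<dotplus> cmul V a C" if "C \<in> CV V" for C
    using cmul_add[OF that, of "b - a" a] assms by simp
  then show ?thesis
    using False assms by (simp add: mrh_scale_class mrh_class_eq_iff cadd_ac)
qed

lemma real_as_diff_nonneg:
  fixes r :: real
  shows "\<exists>a b. a \<ge> 0 \<and> b \<ge> 0 \<and> r = a - b"
  by (intro exI[of _ "max r 0"] exI[of _ "max (- r) 0"]) auto

lemma real_vector_space_on_mrh:
  "real_vector_space_on (mrh V) (mrh_add V) (mrh_class V V V) (mrh_scale V)"
proof
  fix x y z and r s :: real
  show "mrh_class V V V \<in> mrh V" by simp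
  assume "x \<in> mrh V"
  then obtain A B where x: "A \<in> CV V" "B \<in> CV V" "x = mrh_class V A B"
    by (rule mrh_E)
  obtain a b where r: "a \<ge> 0" "b \<ge> 0" "r = a - b"
    using real_as_diff_nonneg by blast
  obtain c d where s: "c \<ge> 0" "d \<ge> 0" "s = c - d"
    using real_as_diff_nonneg by blast
  show "mrh_add V x (mrh_class V V V) = x"
    using x by (simp add: mrh_add_class)
  show "\<exists>y\<in>mrh V. mrh_add V x y = mrh_class V V V"
    using x by (intro bexI[of _ "mrh_class V B A"])
      (simp_all add: mrh_add_class mrh_class_eq_iff cadd_commute)
  show "mrh_scale V r x \<in> mrh V"
    using x by (simp add: mrh_scale_class)
  show "mrh_scale V 1 x = x"
    using x by (simp add: mrh_scale_class cmul_one)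
  show "mrh_scale V (r + s) x = mrh_add V (mrh_scale V r x) (mrh_scale V s x)"
  proof -
    have rs: "r + s = (a + c) - (b + d)" using r s by simp
    have "mrh_scale V (r + s) x = mrh_class V (cmul V (a + c) A \<dotplus> cmul V (b + d) B)
        (cmul V (a + c) B \<dotplus> cmul V (b + d) A)"
      unfolding rs x(3) using x(1,2) r(1,2) s(1,2) by (intro mrh_scale_diff_class) simp_all
    also have "\<dots> = mrh_add V (mrh_scale V r x) (mrh_scale V s x)"
      using x r s by (simp add: mrh_scale_diff_class mrh_add_class cmul_add cadd_ac)
    finally show ?thesis .
  qed
  show "mrh_scale V r (mrh_scale V s x) = mrh_scale V (r * s) x"
  proof -
    have rs: "r * s = (a * c + b * d) - (a * d + b * c)" unfolding r s by (simp add: algebra_simps)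
    have "mrh_scale V (r * s) x = mrh_class V (cmul V (a * c + b * d) A \<dotplus> cmul V (a * d + b * c) B)
        (cmul V (a * c + b * d) B \<dotplus> cmul V (a * d + b * c) A)"
      unfolding rs x(3) using x(1,2) r(1,2) s(1,2) by (intro mrh_scale_diff_class) simp_all
    also have "\<dots> = mrh_scale V r (mrh_scale V s x)"
      using x r s
      by (simp add: mrh_scale_diff_class cmul_add cmul_cadd cmul_cmul cadd_ac)
    finally show ?thesis by simp
  qed
  assume "y \<in> mrh V"
  then obtain C D where y: "C \<in> CV V" "D \<in> CV V" "y = mrh_class V C D"
    by (rule mrh_E)
  show "mrh_add V x y \<in> mrh V"
    using x y by (simp add: mrh_add_class)
  show "mrh_add V x y = mrh_add V y x"
    using x y by (simp add: mrh_add_class cadd_commute)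
  show "mrh_scale V r (mrh_add V x y) = mrh_add V (mrh_scale V r x) (mrh_scale V r y)"
    using x y r by (simp add: mrh_scale_diff_class mrh_add_class cmul_cadd cadd_ac)
  assume "z \<in> mrh V"
  then obtain E F where z: "E \<in> CV V" "F \<in> CV V" "z = mrh_class V E F"
    by (rule mrh_E)
  show "mrh_add V (mrh_add V x y) z = mrh_add V x (mrh_add V y z)"
    using x y z by (simp add: mrh_add_class cadd_assoc)
qed

section \<open>The canonical map\<close>

lemma canon_mrh: "A \<in> CV V \<Longrightarrow> canon V A \<in> mrh V"
  by (simp add: canon_def)

lemma inj_on_canon: "inj_on (canon V) (CV V)"
  by (rule inj_onI) (simp add: canon_def mrh_class_eq_iff)

lemma canon_cadd:
  "A \<in> CV V \<Longrightarrow> B \<in> CV V \<Longrightarrow> canon V (A \<dotplus> B) = mrh_add V (canon V A) (canon V B)"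
  by (simp add: canon_def mrh_add_class)

lemma canon_cmul:
  assumes "r \<ge> 0" "A \<in> CV V"
  shows "canon V (cmul V r A) = mrh_scale V r (canon V A)"
proof -
  have "cmul V r V = V"
    using assms(1) by (cases "r = 0") (auto simp: cmul_def scaleR_V)
  then show ?thesis
    using assms by (simp add: canon_def mrh_scale_class)
qed

text \<open>Membership in a basic neighbourhood can be tested on every representative, since closeness is
  invariant under adding and cancelling a common summand.\<close>

lemma class_mem_TU_iff:
  assumes "A \<in> CV V" "B \<in> CV V"
  shows "mrh_class V A B \<in> TU V U \<longleftrightarrow> near U A B"
proof
  assume "mrh_class V A B \<in> TU V U"
  then obtain C D where *: "C \<in> CV V" "D \<in> CV V" "near U C D" "A \<dotplus> D = B \<dotplus> C"
    using assms by (auto simp: TU_def mrh_class_eq_iff)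
  have "near U (A \<dotplus> D) (B \<dotplus> D)"
    using * assms near_cadd_cancel[of C D B U] by (simp add: cadd_commute)
  then show "near U A B"
    using * assms near_cadd_cancel by blast
qed (use assms in \<open>auto simp: TU_def\<close>)

end

section \<open>Topologies given by balls\<close>

text \<open>A common form of the uniform topology of the cone and of the vector topology: a set is open iff with
  every point it contains a ball around it. The balls need not be open; the halving axiom ensures that
  they are neighbourhoods of their centres.\<close>

locale ball_topology =
  fixes S :: "'b set" and I :: "'i set" and N :: "'i \<Rightarrow> 'b \<Rightarrow> 'b set" and T :: "'b topology"
  assumes openin_iff: "openin T G \<longleftrightarrow> G \<subseteq> S \<and> (\<forall>x\<in>G. \<exists>U\<in>I. N U x \<subseteq> G)"
    and nonempty: "I \<noteq> {}"
    and ball_subset: "U \<in> I \<Longrightarrow> x \<in> S \<Longrightarrow> N U x \<subseteq> S"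
    and centre_in_ball: "U \<in> I \<Longrightarrow> x \<in> S \<Longrightarrow> x \<in> N U x"
    and half_ball: "U \<in> I \<Longrightarrow> \<exists>U'\<in>I. \<forall>x\<in>S. \<forall>y\<in>N U' x. N U' y \<subseteq> N U x"
begin

lemma topspace_ball_topology: "topspace T = S"
proof
  show "topspace T \<subseteq> S"
    using openin_topspace[of T] unfolding openin_iff by blast
  have "openin T S"
    using nonempty ball_subset by (auto simp: openin_iff)
  then show "S \<subseteq> topspace T" by (rule openin_subset)
qed

lemma open_in_ball:
  assumes "U \<in> I" "x \<in> S"
  obtains G where "openin T G" "x \<in> G" "G \<subseteq> N U x"
proof -
  \<comment> \<open>the interior of the ball; halving shows that it is open\<close>
  let ?G = "{y \<in> S. \<exists>W\<in>I. N W y \<subseteq> N U x}"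
  have "\<exists>U\<in>I. N U y \<subseteq> ?G" if y: "y \<in> ?G" for y
  proof -
    obtain W where W: "y \<in> S" "W \<in> I" "N W y \<subseteq> N U x" using y by blast
    obtain W' where W': "W' \<in> I" "\<forall>z\<in>N W' y. N W' z \<subseteq> N W y"
      using half_ball[OF W(2)] W(1) by blast
    then have "N W' y \<subseteq> ?G"
      using W ball_subset[OF W'(1) W(1)] by blast
    then show ?thesis using W' by blast
  qed
  then have "openin T ?G"
    unfolding openin_iff by blast
  moreover have "x \<in> ?G" using assms by blast
  moreover have "?G \<subseteq> N U x" using centre_in_ball by blast
  ultimately show ?thesis by (rule that)
qed

lemma continuous_map_ballI:
  assumes "\<And>x. x \<in> topspace X \<Longrightarrow> f x \<in> S"
    and "\<And>x U. x \<in> topspace X \<Longrightarrow> U \<in> I \<Longrightarrow> \<exists>G. openin X G \<and> x \<in> G \<and> f ` G \<subseteq> N U (f x)"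
  shows "continuous_map X T f"
  unfolding continuous_map_eq_topcontinuous_at topcontinuous_at_def
proof (intro ballI conjI allI impI)
  fix x H assume x: "x \<in> topspace X" and "openin T H \<and> f x \<in> H"
  then obtain U where "U \<in> I" "N U (f x) \<subseteq> H" by (auto simp: openin_iff)
  then show "\<exists>G. openin X G \<and> x \<in> G \<and> (\<forall>y\<in>G. f y \<in> H)"
    using assms(2)[OF x, of U] by blast
qed (use assms(1) in \<open>auto simp: topspace_ball_topology\<close>)

end

lemma homeomorphic_map_ball_topologies:
  assumes X: "ball_topology S I N X" and Y: "ball_topology S' I N' Y"
    and f: "inj_on f S" "f ` S \<subseteq> S'"
    and balls: "\<And>U x y. U \<in> I \<Longrightarrow> x \<in> S \<Longrightarrow> y \<in> S \<Longrightarrow> f y \<in> N' U (f x) \<longleftrightarrow> y \<in> N U x"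
  shows "homeomorphic_map X (subtopology Y (f ` S)) f"
proof -
  interpret X: ball_topology S I N X by (rule X)
  interpret Y: ball_topology S' I N' Y by (rule Y)
  have "continuous_map X Y f"
  proof (rule Y.continuous_map_ballI)
    fix x assume "x \<in> topspace X"
    then have x: "x \<in> S" by (simp add: X.topspace_ball_topology)
    then show "f x \<in> S'" using f by blast
    fix U assume U: "U \<in> I"
    obtain G where "openin X G" "x \<in> G" "G \<subseteq> N U x"
      using X.open_in_ball[OF U x] .
    moreover have "f ` N U x \<subseteq> N' U (f x)"
      using balls[OF U x] X.ball_subset[OF U x] by blast
    ultimately show "\<exists>G. openin X G \<and> x \<in> G \<and> f ` G \<subseteq> N' U (f x)" by blast
  qed
  then have cont: "continuous_map X (subtopology Y (f ` S)) f"
    by (simp add: continuous_map_in_subtopology X.topspace_ball_topology)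
  have "open_map X (subtopology Y (f ` S)) f"
    unfolding open_map_def
  proof (intro allI impI)
    fix G assume G: "openin X G"
    show "openin (subtopology Y (f ` S)) (f ` G)"
    proof (subst openin_subopen, intro ballI)
      fix y assume "y \<in> f ` G"
      then obtain x where x: "x \<in> G" "y = f x" by blast
      obtain U where U: "U \<in> I" "N U x \<subseteq> G" and "G \<subseteq> S"
        using G x by (auto simp: X.openin_iff)
      obtain H where H: "openin Y H" "f x \<in> H" "H \<subseteq> N' U (f x)"
        using Y.open_in_ball[OF U(1), of "f x"] x f \<open>G \<subseteq> S\<close> by blast
      have "H \<inter> f ` S \<subseteq> f ` G"
        using H balls[OF U(1)] U x \<open>G \<subseteq> S\<close> by blast
      moreover have "openin (subtopology Y (f ` S)) (H \<inter> f ` S)"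
        using H(1) by (rule openin_subtopology_Int)
      ultimately show "\<exists>H. openin (subtopology Y (f ` S)) H \<and> y \<in> H \<and> H \<subseteq> f ` G"
        using H x \<open>G \<subseteq> S\<close> by blast
    qed
  qed
  moreover have "f ` topspace X = topspace (subtopology Y (f ` S))"
    using f(2) by (simp add: X.topspace_ball_topology Y.topspace_ball_topology inf_absorb2)
  moreover have "inj_on f (topspace X)"
    using f(1) by (simp add: X.topspace_ball_topology)
  ultimately show ?thesis
    by (rule bijective_open_imp_homeomorphic_map[OF cont])
qed

text \<open>Continuity into a space can be tested after embedding it. This transfers the continuity of the
  operations from the vector space of pairs to the cone.\<close>

lemma continuous_map_into_homeomorphic:
  assumes j: "homeomorphic_map T (subtopology T' Z) j"
    and f: "f \<in> topspace X \<rightarrow> topspace T" and cont: "continuous_map X T' (j \<circ> f)"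
  shows "continuous_map X T f"
proof -
  obtain g where g: "homeomorphic_maps T (subtopology T' Z) j g"
    using j homeomorphic_map_maps by blast
  have "j ` topspace T \<subseteq> Z"
    using homeomorphic_imp_surjective_map[OF j] by auto
  then have "continuous_map X (subtopology T' Z) (j \<circ> f)"
    using cont f unfolding continuous_map_in_subtopology by fastforce
  then have "continuous_map X T (g \<circ> (j \<circ> f))"
    using g by (auto simp: homeomorphic_maps_def intro: continuous_map_compose)
  then show ?thesis
    by (rule continuous_map_eq) (use g f in \<open>auto simp: homeomorphic_maps_def\<close>)
qed

section \<open>Vector topologies from neighbourhoods of the origin\<close>

text \<open>The usual conditions on a basis of neighbourhoods of the origin for a vector topology. Balancedness
  appears as the uniform bound over all \<open>\<bar>r\<bar> \<le> M\<close>.\<close>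

locale vector_topology_base = real_vector_space_on S add zero scale
  for S :: "'b set" and add zero scale +
  fixes I :: "'i set" and B :: "'i \<Rightarrow> 'b set" and T :: "'b topology"
  assumes openin_iff: "openin T G \<longleftrightarrow> G \<subseteq> S \<and> (\<forall>x\<in>G. \<exists>U\<in>I. add x ` B U \<subseteq> G)"
    and nonempty: "I \<noteq> {}"
    and base_subset: "U \<in> I \<Longrightarrow> B U \<subseteq> S"
    and zero_in_base: "U \<in> I \<Longrightarrow> zero \<in> B U"
    and base_add: "U \<in> I \<Longrightarrow> \<exists>U'\<in>I. \<forall>x\<in>B U'. \<forall>y\<in>B U'. add x y \<in> B U"
    and base_scale:
      "U \<in> I \<Longrightarrow> M > 0 \<Longrightarrow> \<exists>U'\<in>I. \<forall>r x. \<bar>r\<bar> \<le> M \<longrightarrow> x \<in> B U' \<longrightarrow> scale r x \<in> B U"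
    and base_absorbing: "U \<in> I \<Longrightarrow> x \<in> S \<Longrightarrow> \<exists>e>0. \<forall>r. \<bar>r\<bar> < e \<longrightarrow> scale r x \<in> B U"
begin

lemma ball_topology_base: "ball_topology S I (\<lambda>U x. add x ` B U) T"
proof
  show "openin T G \<longleftrightarrow> G \<subseteq> S \<and> (\<forall>x\<in>G. \<exists>U\<in>I. add x ` B U \<subseteq> G)" for G
    by (rule openin_iff)
  show "I \<noteq> {}" by (rule nonempty)
  fix U assume U: "U \<in> I"
  show "add x ` B U \<subseteq> S" if "x \<in> S" for x
    using base_subset[OF U] add_closed that by blast
  show "x \<in> add x ` B U" if "x \<in> S" for x
    using zero_in_base[OF U] add_zero[OF that] by force
  obtain U' where U': "U' \<in> I" "\<forall>x\<in>B U'. \<forall>y\<in>B U'. add x y \<in> B U"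
    using base_add[OF U] by blast
  show "\<exists>U'\<in>I. \<forall>x\<in>S. \<forall>y\<in>add x ` B U'. add y ` B U' \<subseteq> add x ` B U"
  proof (intro bexI[OF _ U'(1)] ballI subsetI)
    fix x y z assume x: "x \<in> S" "y \<in> add x ` B U'" "z \<in> add y ` B U'"
    then obtain b c where bc: "b \<in> B U'" "c \<in> B U'" "z = add (add x b) c" by blast
    then have "z = add x (add b c)"
      using x base_subset[OF U'(1)] by (auto intro: add_assoc)
    then show "z \<in> add x ` B U" using bc U' by blast
  qed
qed

sublocale ball_topology S I "\<lambda>U x. add x ` B U" T
  by (rule ball_topology_base)

lemma continuous_add_base: "continuous_map (prod_topology T T) T (\<lambda>(x, y). add x y)"
proof (rule continuous_map_ballI; clarsimp simp: topspace_ball_topology)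
  fix x y assume x: "x \<in> S" and y: "y \<in> S"
  then show "add x y \<in> S" by (rule add_closed)
  fix U assume "U \<in> I"
  then obtain U' where U': "U' \<in> I" "\<forall>x\<in>B U'. \<forall>y\<in>B U'. add x y \<in> B U"
    using base_add by blast
  obtain G where G: "openin T G" "x \<in> G" "G \<subseteq> add x ` B U'"
    using open_in_ball[OF U'(1) x] .
  obtain H where H: "openin T H" "y \<in> H" "H \<subseteq> add y ` B U'"
    using open_in_ball[OF U'(1) y] .
  have "add g h \<in> add (add x y) ` B U" if g: "g \<in> G" and h: "h \<in> H" for g h
  proof -
    obtain b c where bc: "b \<in> B U'" "c \<in> B U'" "g = add x b" "h = add y c"
      using g h G H by blast
    then have S: "b \<in> S" "c \<in> S" using base_subset[OF U'(1)] by auto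
    have "add g h = add x (add b (add y c))"
      using S x y by (simp add: bc add_assoc add_closed)
    also have "add b (add y c) = add y (add b c)"
      using S x y by (metis add_assoc add_commute)
    finally have "add g h = add (add x y) (add b c)"
      using S x y by (simp add: add_assoc add_closed)
    then show ?thesis using U' bc by blast
  qed
  then show "\<exists>G. openin (prod_topology T T) G \<and> (x, y) \<in> G \<and> (\<lambda>(x, y). add x y) ` G \<subseteq> add (add x y) ` B U"
    using G H by (intro exI[of _ "G \<times> H"]) (auto simp: openin_prod_Times_iff)
qed

lemma continuous_scale_base: "continuous_map (prod_topology euclideanreal T) T (\<lambda>(r, x). scale r x)"
proof (rule continuous_map_ballI; clarsimp simp: topspace_ball_topology)
  fix r x assume x: "x \<in> S"
  then show "scale r x \<in> S" by (rule scale_closed)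
  fix U assume "U \<in> I"
  then obtain U' where U': "U' \<in> I" "\<forall>x\<in>B U'. \<forall>y\<in>B U'. add x y \<in> B U"
    using base_add by blast
  obtain e where e: "e > 0" "\<forall>t. \<bar>t\<bar> < e \<longrightarrow> scale t x \<in> B U'"
    using base_absorbing[OF U'(1) x] by blast
  obtain W where W: "W \<in> I" "\<forall>s b. \<bar>s\<bar> \<le> \<bar>r\<bar> + 1 \<longrightarrow> b \<in> B W \<longrightarrow> scale s b \<in> B U'"
    using base_scale[OF U'(1), of "\<bar>r\<bar> + 1"] by fastforce
  obtain G where G: "openin T G" "x \<in> G" "G \<subseteq> add x ` B W"
    using open_in_ball[OF W(1) x] .
  have "scale s g \<in> add (scale r x) ` B U" if s: "s \<in> ball r (min e 1)" and g: "g \<in> G" for s g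
  proof -
    obtain b where b: "b \<in> B W" "g = add x b" using g G by blast
    then have S: "b \<in> S" using base_subset[OF W(1)] by auto
    \<comment> \<open>the decomposition \<open>s (x + b) = r x + ((s - r) x + s b)\<close>: the second term is small
      because \<open>B U'\<close> absorbs \<open>x\<close>, the third because \<open>s\<close> stays bounded\<close>
    have "scale s x = add (scale r x) (scale (s - r) x)"
      using scale_add_left[OF x, of r "s - r"] by simp
    then have eq: "scale s g = add (scale r x) (add (scale (s - r) x) (scale s b))"
      using S x by (simp add: b scale_add_right add_assoc scale_closed)
    have "scale (s - r) x \<in> B U'"
      using e s by (simp add: dist_real_def abs_minus_commute)
    moreover have "scale s b \<in> B U'"
      using W b s by (auto simp: dist_real_def)
    ultimately show ?thesis using U' eq by blast
  qed
  then show "\<exists>G. openin (prod_topology euclideanreal T) G \<and> (r, x) \<in> G \<and>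
      (\<lambda>(r, x). scale r x) ` G \<subseteq> add (scale r x) ` B U"
    using G e by (intro exI[of _ "ball r (min e 1) \<times> G"]) (auto simp: openin_prod_Times_iff)
qed

lemma real_tvs_on_base: "real_tvs_on S add zero scale T"
  by unfold_locales (rule topspace_ball_topology continuous_add_base continuous_scale_base)+

end

section \<open>The two topologies\<close>

lemma balanced_nhds_basis_nonempty: "balanced_nhds_basis \<W> \<Longrightarrow> \<W> \<noteq> {}"
  unfolding balanced_nhds_basis_def using interior_UNIV by blast

lemma balanced_nhds_basis_scaleR:
  assumes \<W>: "balanced_nhds_basis \<W>" and "U \<in> \<W>" "M > 0"
  obtains U' where "U' \<in> \<W>" "\<And>r. \<bar>r\<bar> \<le> M \<Longrightarrow> (\<lambda>x. r *\<^sub>R x) ` U' \<subseteq> U"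
proof -
  have U: "balanced U" "0 \<in> interior U"
    using \<W> \<open>U \<in> \<W>\<close> by (auto simp: balanced_nhds_basis_def)
  have "0 \<in> interior ((\<lambda>x. (1 / M) *\<^sub>R x) ` U)"
    using U(2) \<open>M > 0\<close> by (intro scaleR_nhds) auto
  then obtain U' where U': "U' \<in> \<W>" "U' \<subseteq> (\<lambda>x. (1 / M) *\<^sub>R x) ` U"
    using \<W> unfolding balanced_nhds_basis_def by blast
  show ?thesis
  proof (rule that[OF U'(1)])
    fix r assume r: "\<bar>r\<bar> \<le> M"
    have "(\<lambda>x. r *\<^sub>R x) ` U' \<subseteq> (\<lambda>x. (r / M) *\<^sub>R x) ` U"
      using image_mono[OF U'(2), of "\<lambda>x. r *\<^sub>R x"] by (simp add: image_image)
    moreover have "(\<lambda>x. (r / M) *\<^sub>R x) ` U \<subseteq> U"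
      using U(1) r \<open>M > 0\<close> by (intro image_subsetI) (simp add: balanced_def)
    ultimately show "(\<lambda>x. r *\<^sub>R x) ` U' \<subseteq> U" by (rule order_trans)
  qed
qed

lemma balanced_nhds_basis_half:
  assumes \<W>: "balanced_nhds_basis \<W>" and "U \<in> \<W>"
  obtains U' where "U' \<in> \<W>" "closure (U' + U') \<subseteq> U"
proof -
  have "0 \<in> interior U"
    using assms by (auto simp: balanced_nhds_basis_def)
  then obtain M where M: "open M" "0 \<in> M" "closure (M + M) \<subseteq> U"
    by (rule closure_add_nhds)
  obtain U' where U': "U' \<in> \<W>" "U' \<subseteq> M"
    using \<W> M(1,2) unfolding balanced_nhds_basis_def by (metis interior_open)
  have "closure (U' + U') \<subseteq> closure (M + M)"
    by (intro closure_mono set_plus_mono2 U'(2))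
  then show ?thesis
    using that U'(1) M(3) by blast
qed

context closed_convex_cone
begin

lemma vector_topology_base_TU:
  assumes \<W>: "balanced_nhds_basis \<W>"
  shows "vector_topology_base (mrh V) (mrh_add V) (mrh_class V V V) (mrh_scale V)
    \<W> (TU V) (sigmaH V \<W>)"
proof (intro vector_topology_base.intro real_vector_space_on_mrh vector_topology_base_axioms.intro)
  show "openin (sigmaH V \<W>) G \<longleftrightarrow> G \<subseteq> mrh V \<and> (\<forall>x\<in>G. \<exists>U\<in>\<W>. mrh_add V x ` TU V U \<subseteq> G)" for G
    by (rule openin_sigmaH[OF \<W>])
  show "\<W> \<noteq> {}" by (rule balanced_nhds_basis_nonempty[OF \<W>])
  fix U assume U: "U \<in> \<W>"
  have U0: "0 \<in> interior U"
    using \<W> U by (auto simp: balanced_nhds_basis_def)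
  show "TU V U \<subseteq> mrh V" by (auto simp: TU_def)
  show "mrh_class V V V \<in> TU V U"
    by (simp add: class_mem_TU_iff near_refl closed_V U0)
  show "\<exists>U'\<in>\<W>. \<forall>x\<in>TU V U'. \<forall>y\<in>TU V U'. mrh_add V x y \<in> TU V U"
  proof -
    obtain U' where U': "U' \<in> \<W>" "closure (U' + U') \<subseteq> U"
      using balanced_nhds_basis_half[OF \<W> U] .
    have "mrh_add V x y \<in> TU V U" if "x \<in> TU V U'" "y \<in> TU V U'" for x y
    proof -
      obtain A B where x: "x = mrh_class V A B" "A \<in> CV V" "B \<in> CV V" "near U' A B"
        using \<open>x \<in> TU V U'\<close> by (auto simp: TU_def)
      obtain C D where y: "y = mrh_class V C D" "C \<in> CV V" "D \<in> CV V" "near U' C D"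
        using \<open>y \<in> TU V U'\<close> by (auto simp: TU_def)
      show ?thesis
        using x y near_cadd[OF x(4) y(4) U'(2)] by (simp add: mrh_add_class class_mem_TU_iff)
    qed
    with U'(1) show ?thesis by blast
  qed
  show "\<exists>U'\<in>\<W>. \<forall>r x. \<bar>r\<bar> \<le> M \<longrightarrow> x \<in> TU V U' \<longrightarrow> mrh_scale V r x \<in> TU V U" if M: "M > 0" for M
  proof -
    obtain U' where U': "U' \<in> \<W>" "\<And>r. \<bar>r\<bar> \<le> M \<Longrightarrow> (\<lambda>x. r *\<^sub>R x) ` U' \<subseteq> U"
      using balanced_nhds_basis_scaleR[OF \<W> U M] by blast
    have "mrh_scale V r x \<in> TU V U" if r: "\<bar>r\<bar> \<le> M" and "x \<in> TU V U'" for r x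
    proof -
      obtain A B where x: "x = mrh_class V A B" "A \<in> CV V" "B \<in> CV V" "near U' A B"
        using \<open>x \<in> TU V U'\<close> by (auto simp: TU_def)
      have near: "near U (cmul V s A) (cmul V s B)" if "0 \<le> s" "s \<le> M" for s
      proof (cases "s = 0")
        case True
        then show ?thesis by (simp add: cmul_zero near_refl closed_V U0)
      next
        case False
        then show ?thesis using near_scaleR[OF x(4)] U'(2)[of s] that by simp
      qed
      show ?thesis
        using x near[of r] near_sym[OF near[of "- r"]] r
        by (simp add: mrh_scale_class class_mem_TU_iff)
    qed
    with U'(1) show ?thesis by blast
  qed
  show "\<exists>e>0. \<forall>r. \<bar>r\<bar> < e \<longrightarrow> mrh_scale V r x \<in> TU V U" if "x \<in> mrh V" for x
  proof -
    obtain A B where x: "A \<in> CV V" "B \<in> CV V" "x = mrh_class V A B"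
      using mrh_E[OF \<open>x \<in> mrh V\<close>] .
    obtain e where e: "e > 0" "\<And>t. 0 \<le> t \<Longrightarrow> t < e \<Longrightarrow> near U (cmul V t A) (cmul V t B)"
      using near_small_multiples[OF x(1,2) U0] by blast
    have "mrh_scale V r x \<in> TU V U" if "\<bar>r\<bar> < e" for r
      using x e(2)[of r] near_sym[OF e(2)[of "- r"]] that
      by (simp add: mrh_scale_class class_mem_TU_iff)
    with e(1) show ?thesis by blast
  qed
qed

text \<open>Adding the two hypotheses gives closeness of \<open>A \<dotplus> B\<close> and \<open>B \<dotplus> C\<close>, from which \<open>B\<close> cancels.\<close>

lemma near_trans:
  assumes "A \<in> CV V" "B \<in> CV V" "C \<in> CV V"
    and "near U A B" "near U B C" "closure (U + U) \<subseteq> U'"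
  shows "near U' A C"
proof -
  have "near U' (A \<dotplus> B) (B \<dotplus> C)"
    using assms by (intro near_cadd)
  then show ?thesis
    using assms near_cadd_cancel by (simp add: cadd_commute[of B])
qed

lemma ball_topology_tauH:
  assumes \<W>: "balanced_nhds_basis \<W>"
  shows "ball_topology (CV V) \<W> (\<lambda>U A. WU V U `` {A}) (tauH V \<W>)"
proof
  show "openin (tauH V \<W>) G \<longleftrightarrow> G \<subseteq> CV V \<and> (\<forall>A\<in>G. \<exists>U\<in>\<W>. WU V U `` {A} \<subseteq> G)" for G
    by (rule openin_tauH[OF \<W>])
  show "\<W> \<noteq> {}" by (rule balanced_nhds_basis_nonempty[OF \<W>])
  fix U assume U: "U \<in> \<W>"
  show "WU V U `` {A} \<subseteq> CV V" for A
    by (auto simp: WU_def)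
  show "A \<in> WU V U `` {A}" if "A \<in> CV V" for A
    using that U \<W> by (auto simp: WU_def balanced_nhds_basis_def intro: near_refl CV_closed)
  obtain U' where U': "U' \<in> \<W>" "closure (U' + U') \<subseteq> U"
    using balanced_nhds_basis_half[OF \<W> U] .
  then show "\<exists>U'\<in>\<W>. \<forall>A\<in>CV V. \<forall>B\<in>WU V U' `` {A}. WU V U' `` {B} \<subseteq> WU V U `` {A}"
    by (intro bexI[OF _ U'(1)]) (auto simp: WU_def intro: near_trans)
qed

text \<open>The embedding carries uniform closeness in the cone to closeness modulo a neighbourhood of the origin,
  because \<open>canon V B - canon V A\<close> is the class of \<open>(B, A)\<close>.\<close>

lemma canon_mem_ball_iff:
  assumes "A \<in> CV V" "B \<in> CV V"
  shows "canon V B \<in> mrh_add V (canon V A) ` TU V U \<longleftrightarrow> near U A B"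
proof
  assume "canon V B \<in> mrh_add V (canon V A) ` TU V U"
  then obtain P Q where *: "P \<in> CV V" "Q \<in> CV V" "near U P Q"
    "canon V B = mrh_add V (canon V A) (mrh_class V P Q)"
    by (auto simp: TU_def)
  then have eq: "B \<dotplus> Q = A \<dotplus> P"
    using assms by (simp add: canon_def mrh_add_class mrh_class_eq_iff)
  have "near U (P \<dotplus> B) (Q \<dotplus> B)"
    using * assms near_cadd_cancel by blast
  then have "near U (B \<dotplus> P) (A \<dotplus> P)"
    using eq by (simp add: cadd_commute)
  then show "near U A B"
    using near_cadd_cancel[of B A P U] * assms near_sym by blast
next
  assume "near U A B"
  then have "mrh_class V B A \<in> TU V U"
    using assms near_sym by (simp add: class_mem_TU_iff)
  moreover have "canon V B = mrh_add V (canon V A) (mrh_class V B A)"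
    using assms by (simp add: canon_def mrh_add_class mrh_class_eq_iff cadd_commute)
  ultimately show "canon V B \<in> mrh_add V (canon V A) ` TU V U"
    by blast
qed

lemma homeomorphic_map_canon:
  assumes \<W>: "balanced_nhds_basis \<W>"
  shows "homeomorphic_map (tauH V \<W>) (subtopology (sigmaH V \<W>) (canon V ` CV V)) (canon V)"
proof (rule homeomorphic_map_ball_topologies[OF ball_topology_tauH[OF \<W>]
      vector_topology_base.ball_topology_base[OF vector_topology_base_TU[OF \<W>]] inj_on_canon])
  show "canon V ` CV V \<subseteq> mrh V"
    using canon_mrh by blast
  show "canon V B \<in> mrh_add V (canon V A) ` TU V U \<longleftrightarrow> B \<in> WU V U `` {A}"
    if "A \<in> CV V" "B \<in> CV V" for A B U
    using that by (simp add: canon_mem_ball_iff WU_def)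
qed

lemma real_tvs_on_mrh:
  "balanced_nhds_basis \<W> \<Longrightarrow>
    real_tvs_on (mrh V) (mrh_add V) (mrh_class V V V) (mrh_scale V) (sigmaH V \<W>)"
  by (rule vector_topology_base.real_tvs_on_base[OF vector_topology_base_TU])

lemma topological_convex_cone_CV:
  assumes \<W>: "balanced_nhds_basis \<W>"
  shows "topological_convex_cone (CV V) (\<dotplus>) V (cmul V) (tauH V \<W>)"
proof (intro topological_convex_cone.intro abstract_convex_cone_CV topological_convex_cone_axioms.intro)
  let ?T = "tauH V \<W>" and ?S = "sigmaH V \<W>"
  interpret S: real_tvs_on "mrh V" "mrh_add V" "mrh_class V V V" "mrh_scale V" ?S
    by (rule real_tvs_on_mrh[OF \<W>])
  note hom = homeomorphic_map_canon[OF \<W>]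
  show top: "topspace ?T = CV V"
    by (rule ball_topology.topspace_ball_topology[OF ball_topology_tauH[OF \<W>]])
  have canon: "continuous_map ?T ?S (canon V)"
    using homeomorphic_imp_continuous_map[OF hom] continuous_map_into_fulltopology by blast
  show "continuous_map (prod_topology ?T ?T) ?T (\<lambda>(A, B). A \<dotplus> B)"
  proof (rule continuous_map_into_homeomorphic[OF hom])
    have "continuous_map (prod_topology ?T ?T) (prod_topology ?S ?S)
        (\<lambda>p. (canon V (fst p), canon V (snd p)))"
      by (intro continuous_map_pairedI continuous_map_compose[OF continuous_map_fst canon, unfolded o_def]
          continuous_map_compose[OF continuous_map_snd canon, unfolded o_def])
    from continuous_map_compose[OF this S.continuous_add]
    show "continuous_map (prod_topology ?T ?T) ?S (canon V \<circ> (\<lambda>(A, B). A \<dotplus> B))"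
      by (rule continuous_map_eq) (auto simp: top canon_cadd)
  qed (auto simp: top)
  show "continuous_map (prod_topology (top_of_set {0..}) ?T) ?T (\<lambda>(r, A). cmul V r A)"
  proof (rule continuous_map_into_homeomorphic[OF hom])
    have "continuous_map (prod_topology (top_of_set {0..}) ?T) (prod_topology euclideanreal ?S)
        (\<lambda>p. (fst p, canon V (snd p)))"
      by (intro continuous_map_pairedI continuous_map_into_fulltopology[OF continuous_map_fst]
          continuous_map_compose[OF continuous_map_snd canon, unfolded o_def])
    from continuous_map_compose[OF this S.continuous_scale]
    show "continuous_map (prod_topology (top_of_set {0..}) ?T) ?S (canon V \<circ> (\<lambda>(r, A). cmul V r A))"
      by (rule continuous_map_eq) (auto simp: top canon_cmul)
  qed (auto simp: top)
qed

end

section \<open>The embedding theorem\<close>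

theorem theorem5p6:
  fixes V :: "'a::real_tvs set" and \<W> :: "'a set set"
  assumes V: "closed V" "convex_cone V"
    and \<W>: "balanced_nhds_basis \<W>"
  shows
    "topological_convex_cone (CV V) (\<dotplus>) V (cmul V) (tauH V \<W>) \<and>
     real_tvs_on (mrh V) (mrh_add V) (mrh_class V V V) (mrh_scale V) (sigmaH V \<W>) \<and>
     canon V ` CV V \<subseteq> mrh V \<and>
     inj_on (canon V) (CV V) \<and>
     (\<forall>A\<in>CV V. \<forall>B\<in>CV V. canon V (A \<dotplus> B) = mrh_add V (canon V A) (canon V B)) \<and>
     (\<forall>r\<ge>0. \<forall>A\<in>CV V. canon V (cmul V r A) = mrh_scale V r (canon V A)) \<and>
     homeomorphic_map (tauH V \<W>) (subtopology (sigmaH V \<W>) (canon V ` CV V)) (canon V)"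
proof -
  interpret closed_convex_cone V
    by unfold_locales (rule V)+
  show ?thesis
    by (intro conjI ballI allI impI image_subsetI topological_convex_cone_CV real_tvs_on_mrh
        homeomorphic_map_canon inj_on_canon canon_mrh canon_cadd canon_cmul \<W>)
qed

end
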